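(* Let $k,n$ be integers with $n/2<k\le n$. If $A$ is an $n\times n$ row stochastic or column stochastic matrix with $\operatorname{rank}A\le k$, then $$\operatorname{per}A\le\frac{1}{2^{n-k}}.$$ Equality holds if and only if $$A=P\bigl(J_2^{\oplus(n-k)}\oplus I_{2k-n}\bigr)Q$$ for some $n\times n$ permutation matrices $P,Q$.
   Context: All matrices are real and rank is ordinary matrix rank. The permanent of an $n\times n$ matrix $A=(a_{ij})$ is $\operatorname{per}A=\sum_{\sigma\in S_n}\prod_{i=1}^n a_{i,\sigma(i)}$. A row stochastic (resp. column stochastic) matrix is an entrywise nonnegative matrix all of whose row sums (resp. column sums) are $1$. $J_2$ is the $2\times2$ matrix with every entry $1/2$, $J_2^{\oplus(n-k)}$ is the block diagonal direct sum of $n-k$ copies of $J_2$ (absent when $n=k$), and $I_{2k-n}$ is the identity matrix of order $2k-n$. *)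

theory Defs
  imports "Jordan_Normal_Form.DL_Rank"
begin

text \<open>As for \<^const>\<open>det\<close>, a non-square matrix gets the junk value 0.\<close>

definition permanent :: "'a :: comm_ring_1 mat \<Rightarrow> 'a" where
  "permanent A =
    (if dim_row A = dim_col A
     then \<Sum>\<sigma> | \<sigma> permutes {0..<dim_row A}. \<Prod>i = 0..<dim_row A. A $$ (i, \<sigma> i)
     else 0)"

definition nonneg_entries :: "real mat \<Rightarrow> bool" where
  "nonneg_entries A \<longleftrightarrow> (\<forall>i < dim_row A. \<forall>j < dim_col A. 0 \<le> A $$ (i, j))"

definition row_stochastic :: "real mat \<Rightarrow> bool" where
  "row_stochastic A \<longleftrightarrow>
    nonneg_entries A \<and> (\<forall>i < dim_row A. (\<Sum>j = 0..<dim_col A. A $$ (i, j)) = 1)"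

definition column_stochastic :: "real mat \<Rightarrow> bool" where
  "column_stochastic A \<longleftrightarrow>
    nonneg_entries A \<and> (\<forall>j < dim_col A. (\<Sum>i = 0..<dim_row A. A $$ (i, j)) = 1)"

definition permutation_matrix :: "nat \<Rightarrow> real mat \<Rightarrow> bool" where
  "permutation_matrix n P \<longleftrightarrow>
    (\<exists>\<sigma>. \<sigma> permutes {0..<n} \<and> P = mat n n (\<lambda>(i, j). if j = \<sigma> i then 1 else 0))"

definition J2 :: "real mat" where
  "J2 = mat 2 2 (\<lambda>_. 1 / 2)"

end

theory Submission
  imports Defs
begin

text \<open>
The bound holds in a homogeneous form: a nonnegative \<open>n \<times> n\<close> matrix \<open>a\<close> of rank at most \<open>k\<close> with row
sums \<open>r i\<close> has permanent at most \<open>(1 / 2) ^ (n - k) * (\<Prod>i. r i)\<close>. This is proved by induction on \<open>n\<close>,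
expanding along a well-chosen column (\<open>per_le_of_factors_through\<close>).

If \<open>k < n\<close>, there is a nonzero vector \<open>x\<close> with \<open>a x = 0\<close>. Let \<open>j\<close> be a position where its modulus is
largest, scaled to \<open>x j = 1\<close>. Row \<open>i\<close> of \<open>a x = 0\<close> expresses \<open>a i j\<close> through the other entries of the row
with coefficients of modulus at most one, hence \<open>a i j \<le> r i / 2\<close> (\<open>kernel_peak_le_half\<close>). The minors
along column \<open>j\<close> have rank at most \<open>k\<close>, order \<open>n - 1\<close> and row sums \<open>r l - a l j\<close>, so by induction the
permanent is at most
\<open>(1 / 2) ^ (n - 1 - k) * (\<Sum>i. a i j * (\<Prod>l\<noteq>i. r l - a l j))\<close>. For \<open>r = 1\<close> the sum is the probability that
exactly one of independent events with probabilities \<open>a i j \<le> 1 / 2\<close> occurs, which is at most \<open>1 / 2\<close>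
(\<open>one_hit_le_half\<close>). This is the missing factor.

That probability equals \<open>1 / 2\<close> only if one event has probability \<open>1 / 2\<close> and at most one further
event is possible (\<open>one_hit_eq_half\<close>). So in the case of equality column \<open>j\<close> has at most two nonzero
entries, their minors are extremal as well, and with the relation \<open>a x = 0\<close> this determines a \<open>J2\<close>
block that splits off (\<open>block_form_if_per_eq\<close>).

A column stochastic matrix is handled through its transpose: permanent, rank bound and the extremal
matrices are all invariant under transposition.
\<close>

section \<open>Permanents over arbitrary index sets\<close>

text \<open>Rows and columns are arbitrary sets, so that deleting row \<open>i\<close> and column \<open>j\<close> is passing to
\<open>R - {i}\<close> and \<open>C - {j}\<close>, with no renumbering. The sum runs over the injections of the columns into
the rows, which are the bijections when the two sets have the same finite size.\<close>

definition per :: "'r set \<Rightarrow> 'c set \<Rightarrow> ('r \<Rightarrow> 'c \<Rightarrow> real) \<Rightarrow> real" where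
  "per R C a = (\<Sum>f | f \<in> C \<rightarrow>\<^sub>E R \<and> inj_on f C. \<Prod>c\<in>C. a (f c) c)"

lemma per_empty [simp]: "per R {} a = 1"
proof -
  have "{f. f \<in> {} \<rightarrow>\<^sub>E R \<and> inj_on f {}} = {\<lambda>_. undefined}"
    by auto
  then show ?thesis
    by (simp add: per_def)
qed

lemma per_cong:
  assumes "\<And>i c. i \<in> R \<Longrightarrow> c \<in> C \<Longrightarrow> a i c = b i c"
  shows "per R C a = per R C b"
  unfolding per_def by (rule sum.cong[OF refl], rule prod.cong[OF refl]) (use assms in \<open>auto simp: PiE_iff\<close>)

lemma per_insert:
  assumes "finite R" "finite C" "j \<notin> C"
  shows "per R (insert j C) a = (\<Sum>i\<in>R. a i j * per (R - {i}) C a)"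
proof -
  let ?I = "\<lambda>R. {f. f \<in> C \<rightarrow>\<^sub>E R \<and> inj_on f C}"
  let ?h = "\<lambda>(i, g). g(j := i)"
  have ext: "{f. f \<in> insert j C \<rightarrow>\<^sub>E R \<and> inj_on f (insert j C)}
      = ?h ` (SIGMA i:R. ?I (R - {i}))" (is "?L = ?h ` ?D")
  proof (intro equalityI subsetI)
    fix f assume f: "f \<in> ?L"
    let ?g = "restrict f C"
    have "?g \<in> ?I (R - {f j})"
      using f assms(3) by (auto simp: PiE_iff inj_on_def)
    moreover have "f = ?h (f j, ?g)"
      using f by (auto simp: PiE_iff extensional_def fun_eq_iff)
    ultimately show "f \<in> ?h ` ?D"
      using f by (intro image_eqI[of _ _ "(f j, ?g)"]) (auto simp: PiE_iff)
  next
    fix f assume "f \<in> ?h ` ?D"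
    then show "f \<in> ?L"
      using assms(3) by (auto simp: PiE_iff inj_on_def extensional_def split: if_splits)
  qed
  have inj: "inj_on ?h ?D"
  proof (rule inj_onI, clarify)
    fix i g i' g'
    assume g: "g \<in> C \<rightarrow>\<^sub>E R - {i}" and g': "g' \<in> C \<rightarrow>\<^sub>E R - {i'}"
      and eq: "g(j := i) = g'(j := i')"
    have "i = i'"
      using fun_cong[OF eq, of j] by simp
    moreover have "g = g'"
    proof
      fix c
      show "g c = g' c"
        using fun_cong[OF eq, of c] g g' assms(3) by (cases "c = j") (auto simp: PiE_iff extensional_def)
    qed
    ultimately show "i = i' \<and> g = g'" by simp
  qed
  have fin: "finite (?I (R - {i}))" for i
    using assms by (intro finite_subset[OF _ finite_PiE[of C "\<lambda>_. R - {i}"]]) auto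
  have "per R (insert j C) a = (\<Sum>p\<in>?D. \<Prod>c\<in>insert j C. a (?h p c) c)"
    unfolding per_def ext by (rule sum.reindex_cong[OF inj refl]) auto
  also have "\<dots> = (\<Sum>p\<in>?D. case p of (i, g) \<Rightarrow> a i j * (\<Prod>c\<in>C. a (g c) c))"
  proof (rule sum.cong[OF refl])
    fix p assume "p \<in> ?D"
    obtain i g where p: "p = (i, g)" by (cases p)
    have "(\<Prod>c\<in>C. a ((g(j := i)) c) c) = (\<Prod>c\<in>C. a (g c) c)"
      using assms(3) by (intro prod.cong) auto
    then show "(\<Prod>c\<in>insert j C. a (?h p c) c) = (case p of (i, g) \<Rightarrow> a i j * (\<Prod>c\<in>C. a (g c) c))"
      using assms p by simp
  qed
  also have "\<dots> = (\<Sum>i\<in>R. \<Sum>g\<in>?I (R - {i}). a i j * (\<Prod>c\<in>C. a (g c) c))"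
    using assms(1) fin by (subst sum.Sigma) auto
  also have "\<dots> = (\<Sum>i\<in>R. a i j * per (R - {i}) C a)"
    by (simp add: per_def sum_distrib_left)
  finally show ?thesis .
qed

lemma per_expand:
  assumes "finite R" "finite C" "j \<in> C"
  shows "per R C a = (\<Sum>i\<in>R. a i j * per (R - {i}) (C - {j}) a)"
  using per_insert[of R "C - {j}" j a] assms by (simp add: insert_absorb)

lemma per_expand_single:
  assumes "finite R" "finite C" "j \<in> C" "p \<in> R" "\<And>i. i \<in> R - {p} \<Longrightarrow> a i j = 0"
  shows "per R C a = a p j * per (R - {p}) (C - {j}) a"
proof -
  have "per R C a = (\<Sum>i\<in>{p}. a i j * per (R - {i}) (C - {j}) a)"
    unfolding per_expand[OF assms(1-3)]
    by (rule sum.mono_neutral_right) (use assms in auto)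
  then show ?thesis by simp
qed

section \<open>The probability of exactly one hit\<close>

text \<open>If \<open>t i + u i = 1\<close> for all \<open>i\<close>, this is the probability that exactly one of independent events with
probabilities \<open>t i\<close> occurs, and \<open>\<Prod>i\<in>R. u i\<close> is the probability that none occurs. Without the
normalisation both scale by \<open>\<Prod>i\<in>R. t i + u i\<close>, which takes the place of the total probability.\<close>

definition one_hit :: "'r set \<Rightarrow> ('r \<Rightarrow> real) \<Rightarrow> ('r \<Rightarrow> real) \<Rightarrow> real" where
  "one_hit R t u = (\<Sum>i\<in>R. t i * (\<Prod>l\<in>R - {i}. u l))"

lemma one_hit_empty [simp]: "one_hit {} t u = 0"
  by (simp add: one_hit_def)

lemma one_hit_insert:
  assumes "finite R" "q \<notin> R"
  shows "one_hit (insert q R) t u = t q * (\<Prod>l\<in>R. u l) + u q * one_hit R t u"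
proof -
  have "(\<Sum>i\<in>R. t i * (\<Prod>l\<in>insert q R - {i}. u l)) = (\<Sum>i\<in>R. u q * (t i * (\<Prod>l\<in>R - {i}. u l)))"
  proof (rule sum.cong[OF refl])
    fix i assume "i \<in> R"
    then have "insert q R - {i} = insert q (R - {i})"
      using assms by auto
    then show "t i * (\<Prod>l\<in>insert q R - {i}. u l) = u q * (t i * (\<Prod>l\<in>R - {i}. u l))"
      using assms by simp
  qed
  then show ?thesis
    using assms by (simp add: one_hit_def sum_distrib_left)
qed

lemma one_hit_nonneg:
  assumes "\<And>i. i \<in> R \<Longrightarrow> 0 \<le> t i" "\<And>i. i \<in> R \<Longrightarrow> 0 \<le> u i"
  shows "0 \<le> one_hit R t u"
  unfolding one_hit_def by (intro sum_nonneg mult_nonneg_nonneg prod_nonneg) (use assms in auto)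

text \<open>Exactly one hit and no hit at all are disjoint events.\<close>

lemma one_hit_add_no_hit_le:
  assumes "finite R" "\<And>i. i \<in> R \<Longrightarrow> 0 \<le> t i" "\<And>i. i \<in> R \<Longrightarrow> 0 \<le> u i"
  shows "one_hit R t u + (\<Prod>i\<in>R. u i) \<le> (\<Prod>i\<in>R. t i + u i)"
  using assms
proof (induction R rule: finite_induct)
  case (insert q R)
  have IH: "one_hit R t u + (\<Prod>i\<in>R. u i) \<le> (\<Prod>i\<in>R. t i + u i)"
    using insert by simp
  have nn: "0 \<le> one_hit R t u" "0 \<le> t q" "0 \<le> u q"
    using insert by (auto intro: one_hit_nonneg)
  have "one_hit (insert q R) t u + (\<Prod>i\<in>insert q R. u i)
      = (t q + u q) * (one_hit R t u + (\<Prod>i\<in>R. u i)) - t q * one_hit R t u"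
    using insert by (simp add: one_hit_insert algebra_simps)
  also have "\<dots> \<le> (t q + u q) * (one_hit R t u + (\<Prod>i\<in>R. u i))"
    using nn by simp
  also have "\<dots> \<le> (t q + u q) * (\<Prod>i\<in>R. t i + u i)"
    using nn IH by (intro mult_left_mono) auto
  finally show ?case
    using insert by simp
qed simp

text \<open>If every event has probability at most one half, then exactly one occurs with probability at most
one half. Let \<open>F\<close> and \<open>G\<close> be the probabilities of one hit and of none among \<open>R\<close>. A further event
\<open>q\<close> gives \<open>t q * G + u q * F = t q * (F + G) + (u q - t q) * F\<close>; here \<open>F + G\<close> is bounded by the whole
and \<open>F\<close>, by induction, by half of it, and the coefficient \<open>u q - t q\<close> is nonnegative.\<close>

lemma one_hit_le_half:
  assumes "finite R" "\<And>i. i \<in> R \<Longrightarrow> 0 \<le> t i" "\<And>i. i \<in> R \<Longrightarrow> t i \<le> u i"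
  shows "2 * one_hit R t u \<le> (\<Prod>i\<in>R. t i + u i)"
  using assms
proof (induction R rule: finite_induct)
  case (insert q R)
  have u: "0 \<le> u i" if "i \<in> R" for i
    using insert.prems(1)[of i] insert.prems(2)[of i] that by auto
  have "one_hit R t u + (\<Prod>i\<in>R. u i) \<le> (\<Prod>i\<in>R. t i + u i)"
    using insert u by (intro one_hit_add_no_hit_le) auto
  then have 1: "t q * (one_hit R t u + (\<Prod>i\<in>R. u i)) \<le> t q * (\<Prod>i\<in>R. t i + u i)"
    using insert by (intro mult_left_mono) auto
  have 2: "(u q - t q) * (2 * one_hit R t u) \<le> (u q - t q) * (\<Prod>i\<in>R. t i + u i)"
    using insert by (intro mult_left_mono) auto
  have "2 * one_hit (insert q R) t u
      = 2 * (t q * (one_hit R t u + (\<Prod>i\<in>R. u i))) + (u q - t q) * (2 * one_hit R t u)"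
    using insert by (simp add: one_hit_insert algebra_simps)
  also have "\<dots> \<le> 2 * (t q * (\<Prod>i\<in>R. t i + u i)) + (u q - t q) * (\<Prod>i\<in>R. t i + u i)"
    using 1 2 by simp
  also have "\<dots> = (\<Prod>i\<in>insert q R. t i + u i)"
    using insert by (simp add: algebra_simps)
  finally show ?case .
qed simp

text \<open>The same computation, now with \<open>u q - t q\<close> positive: equality needs an event of probability exactly
one half.\<close>

lemma one_hit_less_half:
  assumes "finite R" "\<And>i. i \<in> R \<Longrightarrow> 0 \<le> t i" "\<And>i. i \<in> R \<Longrightarrow> t i < u i"
  shows "2 * one_hit R t u < (\<Prod>i\<in>R. t i + u i)"
  using assms
proof (induction R rule: finite_induct)
  case (insert q R)
  have u: "0 \<le> u i" if "i \<in> R" for i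
    using insert.prems(1)[of i] insert.prems(2)[of i] that by auto
  have "one_hit R t u + (\<Prod>i\<in>R. u i) \<le> (\<Prod>i\<in>R. t i + u i)"
    using insert u by (intro one_hit_add_no_hit_le) auto
  then have 1: "t q * (one_hit R t u + (\<Prod>i\<in>R. u i)) \<le> t q * (\<Prod>i\<in>R. t i + u i)"
    using insert by (intro mult_left_mono) auto
  have 2: "(u q - t q) * (2 * one_hit R t u) < (u q - t q) * (\<Prod>i\<in>R. t i + u i)"
    using insert by (intro mult_strict_left_mono) auto
  have "2 * one_hit (insert q R) t u
      = 2 * (t q * (one_hit R t u + (\<Prod>i\<in>R. u i))) + (u q - t q) * (2 * one_hit R t u)"
    using insert by (simp add: one_hit_insert algebra_simps)
  also have "\<dots> < 2 * (t q * (\<Prod>i\<in>R. t i + u i)) + (u q - t q) * (\<Prod>i\<in>R. t i + u i)"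
    using 1 2 by simp
  also have "\<dots> = (\<Prod>i\<in>insert q R. t i + u i)"
    using insert by (simp add: algebra_simps)
  finally show ?case .
qed simp

lemma one_hit_pos:
  assumes "finite R" "\<And>i. i \<in> R \<Longrightarrow> 0 \<le> t i" "\<And>i. i \<in> R \<Longrightarrow> 0 < u i"
    and "p \<in> R" "0 < t p"
  shows "0 < one_hit R t u"
  unfolding one_hit_def
proof (rule sum_pos2[OF assms(1,4)])
  show "0 < t p * (\<Prod>l\<in>R - {p}. u l)"
    using assms by (intro mult_pos_pos prod_pos) auto
  show "0 \<le> t i * (\<Prod>l\<in>R - {i}. u l)" if "i \<in> R" for i
    using assms that by (intro mult_nonneg_nonneg prod_nonneg) (auto intro: less_imp_le)
qed

text \<open>If at most one hit is certain, then two events cannot both have positive probability, because by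
independence they would occur together with positive probability.\<close>

lemma almost_no_hit_if_one_hit_add_no_hit_eq:
  assumes "finite R" "\<And>i. i \<in> R \<Longrightarrow> 0 \<le> t i" "\<And>i. i \<in> R \<Longrightarrow> 0 < u i"
    and eq: "one_hit R t u + (\<Prod>i\<in>R. u i) = (\<Prod>i\<in>R. t i + u i)"
  shows "\<exists>q. \<forall>l\<in>R - {q}. t l = 0"
proof (cases "\<exists>q\<in>R. 0 < t q")
  case True
  then obtain q where q: "q \<in> R" "0 < t q" by blast
  obtain S where R: "R = insert q S" and S': "q \<notin> S"
    using q(1) by (meson mk_disjoint_insert)
  then have S: "finite S" "q \<notin> S" using assms(1) by auto
  have le: "one_hit S t u + (\<Prod>i\<in>S. u i) \<le> (\<Prod>i\<in>S. t i + u i)"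
    using assms S by (intro one_hit_add_no_hit_le) (auto simp: R intro: less_imp_le)
  have "0 < u q" using assms q by auto
  then have "(t q + u q) * (one_hit S t u + (\<Prod>i\<in>S. u i)) \<le> (t q + u q) * (\<Prod>i\<in>S. t i + u i)"
    using q le by (intro mult_left_mono) auto
  moreover have "one_hit R t u + (\<Prod>i\<in>R. u i)
      = (t q + u q) * (one_hit S t u + (\<Prod>i\<in>S. u i)) - t q * one_hit S t u"
    using S by (simp add: R one_hit_insert algebra_simps)
  moreover have "(\<Prod>i\<in>R. t i + u i) = (t q + u q) * (\<Prod>i\<in>S. t i + u i)"
    using S by (simp add: R)
  ultimately have "t q * one_hit S t u \<le> 0"
    using eq by linarith
  then have "\<not> 0 < one_hit S t u"
    using q by (simp add: mult_le_0_iff)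
  then have "\<forall>l\<in>S. \<not> 0 < t l"
    using one_hit_pos[of S t u] assms(2,3) S by (auto simp: R)
  then show ?thesis
    using assms(2) by (intro exI[of _ q]) (force simp: R)
next
  case False
  then show ?thesis using assms(2) by force
qed

text \<open>Conditioning on an event \<open>p\<close> of probability one half, one hit in total has probability half of the
probability of at most one hit among the others; so equality forces the latter to be certain.\<close>

lemma one_hit_eq_half:
  assumes "finite R" "\<And>i. i \<in> R \<Longrightarrow> 0 \<le> t i" "\<And>i. i \<in> R \<Longrightarrow> t i \<le> u i"
    and pos: "\<And>i. i \<in> R \<Longrightarrow> 0 < t i + u i"
    and eq: "2 * one_hit R t u = (\<Prod>i\<in>R. t i + u i)"
  obtains p q where "p \<in> R" "t p = u p" "\<And>l. l \<in> R - {p, q} \<Longrightarrow> t l = 0"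
proof -
  have u: "0 < u i" if "i \<in> R" for i
    using assms(2)[OF that] assms(3)[OF that] pos[OF that] by auto
  obtain p where p: "p \<in> R" "t p = u p"
    using one_hit_less_half[of R t u] assms(1-3) eq by force
  obtain S where R: "R = insert p S" and S': "p \<notin> S"
    using p(1) by (meson mk_disjoint_insert)
  then have S: "finite S" "p \<notin> S" using assms(1) by auto
  have "2 * one_hit R t u = 2 * u p * (one_hit S t u + (\<Prod>i\<in>S. u i))"
    using S p by (simp add: R one_hit_insert algebra_simps)
  moreover have "(\<Prod>i\<in>R. t i + u i) = 2 * u p * (\<Prod>i\<in>S. t i + u i)"
    using S p by (simp add: R)
  ultimately have "one_hit S t u + (\<Prod>i\<in>S. u i) = (\<Prod>i\<in>S. t i + u i)"
    using eq u[OF p(1)] by simp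
  then obtain q where "\<forall>l\<in>S - {q}. t l = 0"
    using almost_no_hit_if_one_hit_add_no_hit_eq[of S t u] assms(1,2) u by (auto simp: R)
  then show thesis
    using p that[of p q] S by (auto simp: R)
qed

section \<open>Rank as inner dimension of a factorisation\<close>

text \<open>Rank at most \<open>k\<close>, expressed by a factorisation with inner dimension \<open>k\<close>. In this form the bound is
visibly inherited by submatrices and invariant under transposition.\<close>

definition factors_through :: "nat \<Rightarrow> 'r set \<Rightarrow> 'c set \<Rightarrow> ('r \<Rightarrow> 'c \<Rightarrow> real) \<Rightarrow> bool" where
  "factors_through k R C a \<longleftrightarrow>
    (\<exists>u w. \<forall>i\<in>R. \<forall>c\<in>C. a i c = (\<Sum>m<k. u i m * w m c))"

lemma factors_through_subset:
  assumes "factors_through k R C a" "R' \<subseteq> R" "C' \<subseteq> C"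
  shows "factors_through k R' C' a"
  using assms unfolding factors_through_def by blast

lemma factors_through_transpose:
  assumes "factors_through k R C a"
  shows "factors_through k C R (\<lambda>c i. a i c)"
proof -
  obtain u w where "\<forall>i\<in>R. \<forall>c\<in>C. a i c = (\<Sum>m<k. u i m * w m c)"
    using assms unfolding factors_through_def by blast
  then have "\<forall>c\<in>C. \<forall>i\<in>R. a i c = (\<Sum>m<k. w m c * u i m)"
    by (simp add: mult.commute)
  then show ?thesis
    unfolding factors_through_def by (intro exI[of _ "\<lambda>c m. w m c"] exI[of _ "\<lambda>m i. u i m"])
qed

text \<open>Gaussian elimination: each equation is used to remove one unknown.\<close>

lemma underdetermined_system:
  fixes w :: "nat \<Rightarrow> 'c \<Rightarrow> real"
  assumes "finite C" "k < card C"
  shows "\<exists>x. (\<exists>c\<in>C. x c \<noteq> 0) \<and> (\<forall>m<k. (\<Sum>c\<in>C. w m c * x c) = 0)"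
  using assms
proof (induction k arbitrary: C w)
  case 0
  then have "C \<noteq> {}" by auto
  then show ?case by (intro exI[of _ "\<lambda>_. 1"]) auto
next
  case (Suc k)
  show ?case
  proof (cases "\<forall>c\<in>C. w k c = 0")
    case True
    obtain x where "\<exists>c\<in>C. x c \<noteq> 0" "\<forall>m<k. (\<Sum>c\<in>C. w m c * x c) = 0"
      using Suc.IH[of C w] Suc.prems by auto
    then show ?thesis
      using True by (intro exI[of _ x]) (auto simp: less_Suc_eq)
  next
    case False
    then obtain c0 where c0: "c0 \<in> C" "w k c0 \<noteq> 0" by blast
    let ?C = "C - {c0}"
    let ?w = "\<lambda>m c. w m c - w m c0 / w k c0 * w k c"
    have "k < card ?C" using Suc.prems c0 by simp
    then obtain x where x: "\<exists>c\<in>?C. x c \<noteq> 0" "\<forall>m<k. (\<Sum>c\<in>?C. ?w m c * x c) = 0"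
      using Suc.IH[of ?C ?w] Suc.prems by auto
    let ?s = "- (\<Sum>c\<in>?C. w k c * x c) / w k c0"
    let ?y = "x(c0 := ?s)"
    have split: "(\<Sum>c\<in>C. w m c * ?y c) = w m c0 * ?s + (\<Sum>c\<in>?C. w m c * x c)" for m
    proof -
      have "(\<Sum>c\<in>?C. w m c * ?y c) = (\<Sum>c\<in>?C. w m c * x c)"
        by (rule sum.cong) auto
      then show ?thesis
        using Suc.prems(1) c0(1) by (simp add: sum.remove)
    qed
    have "(\<Sum>c\<in>C. w m c * ?y c) = 0" if "m < k" for m
    proof -
      have "(\<Sum>c\<in>?C. ?w m c * x c) = (\<Sum>c\<in>?C. w m c * x c) - w m c0 / w k c0 * (\<Sum>c\<in>?C. w k c * x c)"
        by (simp add: sum_subtractf sum_distrib_left left_diff_distrib mult.assoc)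
      then show ?thesis
        unfolding split using x(2) that c0(2) by (auto simp: field_simps)
    qed
    moreover have "(\<Sum>c\<in>C. w k c * ?y c) = 0"
      unfolding split using c0(2) by simp
    moreover have "\<exists>c\<in>C. ?y c \<noteq> 0"
      using x(1) by auto
    ultimately show ?thesis
      by (intro exI[of _ ?y]) (auto simp only: less_Suc_eq)
  qed
qed

text \<open>The kernel vector is scaled by its entry of largest modulus.\<close>

lemma normalised_kernel_vector:
  assumes "finite C" "k < card C" "factors_through k R C a"
  obtains x j where "j \<in> C" "x j = 1" "\<And>c. c \<in> C \<Longrightarrow> \<bar>x c\<bar> \<le> 1"
    "\<And>i. i \<in> R \<Longrightarrow> (\<Sum>c\<in>C. a i c * x c) = 0"
proof -
  obtain u w where uw: "\<forall>i\<in>R. \<forall>c\<in>C. a i c = (\<Sum>m<k. u i m * w m c)"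
    using assms(3) unfolding factors_through_def by blast
  obtain y where y: "\<exists>c\<in>C. y c \<noteq> 0" "\<forall>m<k. (\<Sum>c\<in>C. w m c * y c) = 0"
    using underdetermined_system[OF assms(1,2), of w] by blast
  have ker: "(\<Sum>c\<in>C. a i c * y c) = 0" if "i \<in> R" for i
  proof -
    have "(\<Sum>c\<in>C. a i c * y c) = (\<Sum>c\<in>C. \<Sum>m<k. u i m * (w m c * y c))"
      using uw that by (intro sum.cong) (auto simp: sum_distrib_right mult.assoc)
    also have "\<dots> = (\<Sum>m<k. u i m * (\<Sum>c\<in>C. w m c * y c))"
      by (subst sum.swap) (simp add: sum_distrib_left)
    finally show ?thesis using y(2) by simp
  qed
  have "\<exists>j\<in>C. \<forall>c\<in>C. \<bar>y c\<bar> \<le> \<bar>y j\<bar>"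
  proof -
    have "Max ((\<lambda>c. \<bar>y c\<bar>) ` C) \<in> (\<lambda>c. \<bar>y c\<bar>) ` C"
      using assms(1) y(1) by (intro Max_in) auto
    then obtain j where "j \<in> C" "\<bar>y j\<bar> = Max ((\<lambda>c. \<bar>y c\<bar>) ` C)" by auto
    then show ?thesis using assms(1) by (intro bexI[of _ j]) auto
  qed
  then obtain j where j: "j \<in> C" "\<forall>c\<in>C. \<bar>y c\<bar> \<le> \<bar>y j\<bar>" by blast
  then have "y j \<noteq> 0" using y(1) by force
  show thesis
  proof (rule that[of j "\<lambda>c. y c / y j"])
    show "j \<in> C" "y j / y j = 1" using j \<open>y j \<noteq> 0\<close> by auto
    show "\<bar>y c / y j\<bar> \<le> 1" if "c \<in> C" for c
      using j that \<open>y j \<noteq> 0\<close> by (simp add: divide_simps)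
    show "(\<Sum>c\<in>C. a i c * (y c / y j)) = 0" if "i \<in> R" for i
      using ker[OF that] by (simp add: sum_divide_distrib[symmetric])
  qed
qed

text \<open>The key estimate. The relation expresses \<open>b j\<close> through the other entries of the row with
coefficients of modulus at most one, so \<open>b j\<close> is at most their sum: a column in which a kernel vector
peaks carries at most half of each row sum.\<close>

lemma kernel_peak_le_half:
  assumes "finite C" "j \<in> C" "x j = 1" "\<And>c. c \<in> C \<Longrightarrow> \<bar>x c\<bar> \<le> 1"
    and "(\<Sum>c\<in>C. b c * x c) = (0 :: real)" "\<And>c. c \<in> C \<Longrightarrow> 0 \<le> b c"
  shows "b j \<le> (\<Sum>c\<in>C - {j}. b c)"
proof -
  have "b j = (\<Sum>c\<in>C - {j}. b c * - x c)"
    using assms(1,2,3,5) by (simp add: sum.remove sum_negf)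
  also have "\<dots> \<le> (\<Sum>c\<in>C - {j}. b c)"
  proof (rule sum_mono)
    fix c assume "c \<in> C - {j}"
    then have "b c * - x c \<le> b c * 1"
      using assms(4)[of c] assms(6)[of c] by (intro mult_left_mono) auto
    then show "b c * - x c \<le> b c" by simp
  qed
  finally show ?thesis .
qed

text \<open>If column \<open>j\<close> is zero outside row \<open>p\<close>, then deleting both lowers the rank, as for a block triangular
matrix with an invertible corner. In terms of the factorisation \<open>a i c = (\<Sum>m<k. u i m * w m c)\<close>,
the vectors \<open>w m\<close> are cleared at \<open>j\<close> by subtracting multiples of a \<open>w m0\<close> that does not vanish
there; rows that vanish at \<open>j\<close> are combinations of the remaining \<open>k - 1\<close> vectors.\<close>

lemma factors_through_delete_pivot:
  assumes "factors_through k R C a" "finite C" "p \<in> R" "j \<in> C" "a p j \<noteq> 0"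
    and zero: "\<And>i. i \<in> R - {p} \<Longrightarrow> a i j = 0"
  shows "0 < k \<and> factors_through (k - 1) (R - {p}) (C - {j}) a"
proof -
  obtain u w where uw: "\<And>i c. i \<in> R \<Longrightarrow> c \<in> C \<Longrightarrow> a i c = (\<Sum>m<k. u i m * w m c)"
    using assms(1) unfolding factors_through_def by blast
  have "(\<Sum>m<k. u p m * w m j) \<noteq> 0" using uw assms(3,4,5) by auto
  then obtain m0 where m0: "m0 < k" "w m0 j \<noteq> 0"
    by (metis (mono_tags, lifting) lessThan_iff mult_zero_right sum.neutral)
  obtain h where h: "bij_betw h {..<k - 1} ({..<k} - {m0})"
    using finite_same_card_bij[of "{..<k - 1}" "{..<k} - {m0}"] m0 by auto
  let ?w = "\<lambda>m c. w m c - w m j / w m0 j * w m0 c"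
  have "a i c = (\<Sum>m<k - 1. u i (h m) * ?w (h m) c)" if i: "i \<in> R - {p}" and c: "c \<in> C - {j}" for i c
  proof -
    \<comment> \<open>in total, this sum divided by \<open>w m0 j\<close> is the multiple of \<open>w m0\<close> that clearing subtracts\<close>
    have z: "(\<Sum>m<k. u i m * w m j) = 0"
      using uw[of i j] zero[OF i] i assms(4) by auto
    have "(\<Sum>m<k - 1. u i (h m) * ?w (h m) c) = (\<Sum>m\<in>{..<k} - {m0}. u i m * ?w m c)"
      by (rule sum.reindex_bij_betw[OF h, of "\<lambda>m. u i m * ?w m c"])
    also have "\<dots> = (\<Sum>m<k. u i m * ?w m c)"
      using m0 by (intro sum.mono_neutral_left) auto
    also have "\<dots> = (\<Sum>m<k. u i m * w m c) - (\<Sum>m<k. u i m * w m j) / w m0 j * w m0 c"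
      by (simp add: algebra_simps sum_subtractf sum_distrib_left sum_distrib_right sum_divide_distrib)
    also have "\<dots> = a i c" using uw[of i c] i c z by auto
    finally show ?thesis by simp
  qed
  then show ?thesis
    using m0 unfolding factors_through_def
    by (intro conjI exI[of _ "\<lambda>i m. u i (h m)"] exI[of _ "\<lambda>m. ?w (h m)"]) auto
qed

section \<open>The bound\<close>

text \<open>Bounds on all minors along one column, each of product form, combine into the one-hit sum.\<close>

lemma per_le_one_hit:
  assumes "finite R" "finite C"
    and "\<And>i c. i \<in> R \<Longrightarrow> c \<in> C \<Longrightarrow> 0 \<le> a i c"
    and "j \<in> C"
    and minors: "\<And>i. i \<in> R \<Longrightarrow> per (R - {i}) (C - {j}) a \<le> \<beta> * (\<Prod>l\<in>R - {i}. u l)"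
  shows "per R C a \<le> \<beta> * one_hit R (\<lambda>i. a i j) u"
proof -
  have "per R C a = (\<Sum>i\<in>R. a i j * per (R - {i}) (C - {j}) a)"
    by (rule per_expand) fact+
  also have "\<dots> \<le> (\<Sum>i\<in>R. a i j * (\<beta> * (\<Prod>l\<in>R - {i}. u l)))"
    using assms(3,4) minors by (intro sum_mono mult_left_mono) auto
  finally show ?thesis
    by (simp add: one_hit_def sum_distrib_left mult.left_commute)
qed

lemma minor_eq_if_per_eq_one_hit:
  assumes "finite R" "finite C"
    and "\<And>i c. i \<in> R \<Longrightarrow> c \<in> C \<Longrightarrow> 0 \<le> a i c"
    and "j \<in> C"
    and minors: "\<And>i. i \<in> R \<Longrightarrow> per (R - {i}) (C - {j}) a \<le> \<beta> * (\<Prod>l\<in>R - {i}. u l)"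
    and eq: "per R C a = \<beta> * one_hit R (\<lambda>i. a i j) u"
    and i: "i \<in> R" "0 < a i j"
  shows "per (R - {i}) (C - {j}) a = \<beta> * (\<Prod>l\<in>R - {i}. u l)"
proof -
  let ?g = "\<lambda>i. \<beta> * (\<Prod>l\<in>R - {i}. u l)"
  have "(\<Sum>i\<in>R. a i j * per (R - {i}) (C - {j}) a) = (\<Sum>i\<in>R. a i j * ?g i)"
    using eq per_expand[OF assms(1,2,4), of a]
    by (simp add: one_hit_def sum_distrib_left mult.left_commute)
  moreover have "a i j * per (R - {i}) (C - {j}) a \<le> a i j * ?g i" if "i \<in> R" for i
    using assms(3,4) minors that by (intro mult_left_mono) auto
  ultimately have "a i j * per (R - {i}) (C - {j}) a = a i j * ?g i"
    by (rule sum_mono_inv) (use i assms(1) in auto)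
  then show ?thesis
    using i(2) by simp
qed

text \<open>The homogeneous form of the bound, for matrices with arbitrary row sums; this generality is needed
because the rows of a minor of a stochastic matrix no longer sum to one. A minor loses a column but
keeps the bound \<open>k\<close> on the rank, so the induction hypothesis for it lacks one factor \<open>1 / 2\<close>. As long
as \<open>k < card C\<close>, this factor is supplied by \<open>one_hit_le_half\<close> at the column where a kernel vector
peaks. Otherwise no factor is required, any column serves, and the one-hit probability is bounded by
one.\<close>

theorem per_le_of_factors_through:
  assumes "finite R" "finite C" "card R = card C"
    and "\<And>i c. i \<in> R \<Longrightarrow> c \<in> C \<Longrightarrow> 0 \<le> a i c"
    and "factors_through k R C a"
  shows "per R C a \<le> (1 / 2) ^ (card C - k) * (\<Prod>i\<in>R. \<Sum>c\<in>C. a i c)"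
  using assms
proof (induction "card C" arbitrary: R C)
  case 0
  then show ?case by simp
next
  case (Suc n)
  have reduce: "per R C a \<le> (1 / 2) ^ (n - k) * one_hit R (\<lambda>i. a i j) (\<lambda>i. \<Sum>c\<in>C - {j}. a i c)"
    if j: "j \<in> C" for j
  proof -
    have minors: "per (R - {i}) (C - {j}) a \<le> (1 / 2) ^ (n - k) * (\<Prod>l\<in>R - {i}. \<Sum>c\<in>C - {j}. a l c)"
      if i: "i \<in> R" for i
    proof -
      have n: "n = card (C - {j})" "card (R - {i}) = card (C - {j})"
        using Suc.hyps(2) Suc.prems(1-3) i j by simp_all
      have "factors_through k (R - {i}) (C - {j}) a"
        using factors_through_subset[OF Suc.prems(5)] by blast
      then show ?thesis
        unfolding n(1) using Suc.prems(1,2,4) by (intro Suc.hyps(1)[OF n(1) _ _ n(2)]) auto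
    qed
    show ?thesis
      by (rule per_le_one_hit) (use Suc.prems(1,2,4) j minors in auto)
  qed
  have sums: "a i j + (\<Sum>c\<in>C - {j}. a i c) = (\<Sum>c\<in>C. a i c)" if "j \<in> C" for i j
    using that Suc.prems(2) by (simp add: sum.remove)
  show ?case
  proof (cases "k < card C")
    case True
    obtain x j where x: "j \<in> C" "x j = 1" "\<And>c. c \<in> C \<Longrightarrow> \<bar>x c\<bar> \<le> 1"
      "\<And>i. i \<in> R \<Longrightarrow> (\<Sum>c\<in>C. a i c * x c) = 0"
      by (rule normalised_kernel_vector[OF Suc.prems(2) True Suc.prems(5)]) metis
    have half: "a i j \<le> (\<Sum>c\<in>C - {j}. a i c)" if "i \<in> R" for i
      by (rule kernel_peak_le_half[of C j x]) (use Suc.prems(2,4) x that in auto)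
    have "2 * one_hit R (\<lambda>i. a i j) (\<lambda>i. \<Sum>c\<in>C - {j}. a i c) \<le> (\<Prod>i\<in>R. \<Sum>c\<in>C. a i c)"
      using one_hit_le_half[of R "\<lambda>i. a i j" "\<lambda>i. \<Sum>c\<in>C - {j}. a i c"] half Suc.prems(1,4) x(1)
      by (simp add: sums)
    then have "(1 / 2) ^ (n - k) * one_hit R (\<lambda>i. a i j) (\<lambda>i. \<Sum>c\<in>C - {j}. a i c)
        \<le> (1 / 2) ^ (n - k) * ((1 / 2) * (\<Prod>i\<in>R. \<Sum>c\<in>C. a i c))"
      by (intro mult_left_mono) auto
    also have "\<dots> = (1 / 2) ^ (card C - k) * (\<Prod>i\<in>R. \<Sum>c\<in>C. a i c)"
      using True by (simp add: Suc.hyps(2)[symmetric] Suc_diff_le)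
    finally show ?thesis
      using reduce[OF x(1)] by simp
  next
    case False
    obtain j where j: "j \<in> C" using Suc.hyps(2) by fastforce
    let ?u = "\<lambda>i. \<Sum>c\<in>C - {j}. a i c"
    have "one_hit R (\<lambda>i. a i j) ?u + (\<Prod>i\<in>R. ?u i) \<le> (\<Prod>i\<in>R. \<Sum>c\<in>C. a i c)"
    proof -
      have "0 \<le> ?u i" if "i \<in> R" for i
        using Suc.prems(4) that by (intro sum_nonneg) auto
      then show ?thesis
        using one_hit_add_no_hit_le[of R "\<lambda>i. a i j" ?u] Suc.prems(1,4) j by (simp add: sums)
    qed
    moreover have "0 \<le> (\<Prod>i\<in>R. ?u i)"
      using Suc.prems(4) by (intro prod_nonneg sum_nonneg) auto
    moreover have "card C - k = 0" "n - k = 0"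
      using False Suc.hyps(2) by auto
    ultimately show ?thesis
      using reduce[OF j] by simp
  qed
qed

section \<open>Direct sums of two-by-two blocks and units\<close>

text \<open>A direct sum of \<open>d\<close> copies of \<open>J2\<close> and an identity matrix, up to permutations of rows and columns and
up to positive scaling of each row. Invariance under row scaling lets the notion be applied directly
to minors.\<close>

inductive block_form :: "('r \<Rightarrow> 'c \<Rightarrow> real) \<Rightarrow> 'r set \<Rightarrow> 'c set \<Rightarrow> nat \<Rightarrow> bool"
  for a where
  empty: "block_form a {} {} 0"
| unit: "block_form a R C d \<Longrightarrow> i \<notin> R \<Longrightarrow> j \<notin> C \<Longrightarrow> a i j > 0 \<Longrightarrow>
    (\<And>c. c \<in> C \<Longrightarrow> a i c = 0) \<Longrightarrow> (\<And>r. r \<in> R \<Longrightarrow> a r j = 0) \<Longrightarrow>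
    block_form a (insert i R) (insert j C) d"
| pair: "block_form a R C d \<Longrightarrow> i \<notin> R \<Longrightarrow> i' \<notin> R \<Longrightarrow> i \<noteq> i' \<Longrightarrow> j \<notin> C \<Longrightarrow> j' \<notin> C \<Longrightarrow> j \<noteq> j' \<Longrightarrow>
    a i j > 0 \<Longrightarrow> a i j' = a i j \<Longrightarrow> a i' j > 0 \<Longrightarrow> a i' j' = a i' j \<Longrightarrow>
    (\<And>c. c \<in> C \<Longrightarrow> a i c = 0 \<and> a i' c = 0) \<Longrightarrow> (\<And>r. r \<in> R \<Longrightarrow> a r j = 0 \<and> a r j' = 0) \<Longrightarrow>
    block_form a (insert i (insert i' R)) (insert j (insert j' C)) (Suc d)"

lemma block_form_finite:
  assumes "block_form a R C d"
  shows "finite R" "finite C"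
  using assms by (induction rule: block_form.induct) auto

lemma block_form_per:
  assumes "block_form a R C d"
  shows "per R C a = (1 / 2) ^ d * (\<Prod>i\<in>R. \<Sum>c\<in>C. a i c)"
  using assms
proof (induction rule: block_form.induct)
  case empty
  then show ?case by simp
next
  case (unit R C d i j)
  note fin = block_form_finite[OF unit.hyps(1)]
  have "per (insert i R) (insert j C) a = a i j * per R C a"
    using per_expand_single[of "insert i R" "insert j C" j i a] fin unit.hyps by simp
  moreover have "(\<Sum>c\<in>insert j C. a i c) = a i j"
    using fin unit.hyps by simp
  moreover have "(\<Prod>r\<in>R. \<Sum>c\<in>insert j C. a r c) = (\<Prod>r\<in>R. \<Sum>c\<in>C. a r c)"
    using fin unit.hyps by (intro prod.cong) auto
  ultimately show ?case
    using fin unit.hyps unit.IH by simp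
next
  case (pair R C d i i' j j')
  note fin = block_form_finite[OF pair.hyps(1)]
  have 1: "per (insert i' R) (insert j' C) a = a i' j' * per R C a"
    using per_expand_single[of "insert i' R" "insert j' C" j' i' a] fin pair.hyps by simp
  have 2: "per (insert i R) (insert j' C) a = a i j' * per R C a"
    using per_expand_single[of "insert i R" "insert j' C" j' i a] fin pair.hyps by simp
  have "per (insert i (insert i' R)) (insert j (insert j' C)) a
      = (\<Sum>l\<in>insert i (insert i' R). a l j * per (insert i (insert i' R) - {l}) (insert j' C) a)"
    using per_insert[of "insert i (insert i' R)" "insert j' C" j a] fin pair.hyps by simp
  also have "\<dots> = (\<Sum>l\<in>{i, i'}. a l j * per (insert i (insert i' R) - {l}) (insert j' C) a)"
    using fin pair.hyps by (intro sum.mono_neutral_right) auto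
  also have "\<dots> = 2 * a i j * a i' j * per R C a"
  proof -
    have "insert i (insert i' R) - {i} = insert i' R" "insert i (insert i' R) - {i'} = insert i R"
      using pair.hyps by auto
    then show ?thesis
      using pair.hyps 1 2 by simp
  qed
  finally have per: "per (insert i (insert i' R)) (insert j (insert j' C)) a = 2 * a i j * a i' j * per R C a" .
  have "(\<Sum>c\<in>insert j (insert j' C). a i c) = 2 * a i j"
    "(\<Sum>c\<in>insert j (insert j' C). a i' c) = 2 * a i' j"
    using fin pair.hyps by auto
  moreover have "(\<Prod>r\<in>R. \<Sum>c\<in>insert j (insert j' C). a r c) = (\<Prod>r\<in>R. \<Sum>c\<in>C. a r c)"
    using fin pair.hyps by (intro prod.cong) auto
  ultimately show ?case
    using fin pair.hyps pair.IH per by simp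
qed

text \<open>The blocks can be split off in any order: whichever row is chosen, the block containing it is
either a unit, and then the rest is again in block form, or a \<open>J2\<close> block.\<close>

lemma block_form_row_cases:
  assumes "block_form a R C d" "q \<in> R"
  obtains (unit) c where "c \<in> C" "a q c > 0" "\<And>c'. c' \<in> C - {c} \<Longrightarrow> a q c' = 0"
      "\<And>r. r \<in> R - {q} \<Longrightarrow> a r c = 0" "block_form a (R - {q}) (C - {c}) d"
    | (pair) q' c c' where "q' \<in> R" "q' \<noteq> q" "c \<in> C" "c' \<in> C" "c \<noteq> c'"
      "a q c' = a q c" "a q' c > 0" "a q' c' = a q' c"
      "\<And>b. b \<in> C - {c, c'} \<Longrightarrow> a q b = 0 \<and> a q' b = 0"
proof -
  have "(\<exists>c\<in>C. a q c > 0 \<and> (\<forall>c'\<in>C - {c}. a q c' = 0) \<and> (\<forall>r\<in>R - {q}. a r c = 0)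
          \<and> block_form a (R - {q}) (C - {c}) d)
    \<or> (\<exists>q'\<in>R. \<exists>c\<in>C. \<exists>c'\<in>C. q' \<noteq> q \<and> c \<noteq> c' \<and> a q c' = a q c \<and> a q' c > 0 \<and> a q' c' = a q' c
          \<and> (\<forall>b\<in>C - {c, c'}. a q b = 0 \<and> a q' b = 0))" (is "?U R C d \<or> ?P R C")
    using assms
  proof (induction rule: block_form.induct)
    case empty
    then show ?case by simp
  next
    case (unit R C d i j)
    show ?case
    proof (cases "q = i")
      case True
      then have eq: "insert i R - {q} = R" "insert j C - {j} = C"
        using unit.hyps by auto
      show ?thesis
        by (rule disjI1, rule bexI[of _ j]) (use True unit.hyps in \<open>simp_all add: eq\<close>)
    next
      case False
      then have q: "q \<in> R" using unit.prems by simp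
      from unit.IH[OF q] show ?thesis
      proof
        assume "?U R C d"
        then obtain c where c: "c \<in> C" "a q c > 0" "\<forall>c'\<in>C - {c}. a q c' = 0" "\<forall>r\<in>R - {q}. a r c = 0"
          "block_form a (R - {q}) (C - {c}) d" by blast
        have "insert i R - {q} = insert i (R - {q})" "insert j C - {c} = insert j (C - {c})"
          using False c(1) unit.hyps by auto
        then have "block_form a (insert i R - {q}) (insert j C - {c}) d"
          using block_form.unit[OF c(5), of i j] unit.hyps(2-6) by simp
        moreover have "\<forall>c'\<in>insert j C - {c}. a q c' = 0" "\<forall>r\<in>insert i R - {q}. a r c = 0"
          using c unit.hyps(5,6) q by blast+
        ultimately show ?thesis
          using c(1,2) by blast
      next
        assume "?P R C"
        then obtain q' c c' where *: "q' \<in> R" "c \<in> C" "c' \<in> C" "q' \<noteq> q" "c \<noteq> c'" "a q c' = a q c"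
          "a q' c > 0" "a q' c' = a q' c" "\<forall>b\<in>C - {c, c'}. a q b = 0 \<and> a q' b = 0" by blast
        have "\<forall>b\<in>insert j C - {c, c'}. a q b = 0 \<and> a q' b = 0"
          using * unit.hyps(6) q by blast
        then show ?thesis
          using * by blast
      qed
    qed
  next
    case (pair R C d i i' j j')
    consider "q = i" | "q = i'" | "q \<in> R" "q \<noteq> i" "q \<noteq> i'"
      using pair.prems by blast
    then show ?case
    proof cases
      case 1
      have zero: "\<forall>b\<in>insert j (insert j' C) - {j, j'}. a q b = 0 \<and> a i' b = 0"
        using 1 pair.hyps(12) by blast
      show ?thesis
        by (rule disjI2, rule bexI[of _ i'], rule bexI[of _ j], rule bexI[of _ j'])
          (use 1 pair.hyps zero in simp_all)
    next
      case 2
      have zero: "\<forall>b\<in>insert j (insert j' C) - {j, j'}. a q b = 0 \<and> a i b = 0"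
        using 2 pair.hyps(12) by blast
      show ?thesis
        by (rule disjI2, rule bexI[of _ i], rule bexI[of _ j], rule bexI[of _ j'])
          (use 2 pair.hyps zero in simp_all)
    next
      case 3
      from pair.IH[OF 3(1)] show ?thesis
      proof
        assume "?U R C d"
        then obtain c where c: "c \<in> C" "a q c > 0" "\<forall>c'\<in>C - {c}. a q c' = 0" "\<forall>r\<in>R - {q}. a r c = 0"
          "block_form a (R - {q}) (C - {c}) d" by blast
        have "insert i (insert i' R) - {q} = insert i (insert i' (R - {q}))"
          "insert j (insert j' C) - {c} = insert j (insert j' (C - {c}))"
          using 3 c(1) pair.hyps by auto
        then have "block_form a (insert i (insert i' R) - {q}) (insert j (insert j' C) - {c}) (Suc d)"
          using block_form.pair[OF c(5), of i i' j j'] pair.hyps(2-13) by simp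
        moreover have "\<forall>c'\<in>insert j (insert j' C) - {c}. a q c' = 0"
          "\<forall>r\<in>insert i (insert i' R) - {q}. a r c = 0"
          using c pair.hyps(12,13) 3(1) by blast+
        ultimately show ?thesis
          using c(1,2) by blast
      next
        assume "?P R C"
        then obtain q' c c' where *: "q' \<in> R" "c \<in> C" "c' \<in> C" "q' \<noteq> q" "c \<noteq> c'" "a q c' = a q c"
          "a q' c > 0" "a q' c' = a q' c" "\<forall>b\<in>C - {c, c'}. a q b = 0 \<and> a q' b = 0" by blast
        have "\<forall>b\<in>insert j (insert j' C) - {c, c'}. a q b = 0 \<and> a q' b = 0"
          using * pair.hyps(13) 3(1) by blast
        then show ?thesis
          using * by blast
      qed
    qed
  qed
  then show thesis
    using unit pair by blast
qed

lemma sum_split_two: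
  fixes f :: "'c \<Rightarrow> real"
  assumes "finite C" "j \<in> C" "c \<in> C" "c \<noteq> j" "\<And>b. b \<in> C - {j, c} \<Longrightarrow> f b = 0"
  shows "(\<Sum>b\<in>C. f b) = f j + f c"
proof -
  have "(\<Sum>b\<in>C. f b) = (\<Sum>b\<in>{j, c}. f b)"
    by (rule sum.mono_neutral_right) (use assms in auto)
  then show ?thesis using assms(4) by simp
qed

lemma zero_if_sum_remove_eq:
  fixes f :: "'c \<Rightarrow> real"
  assumes "finite C" "c \<in> C" "\<And>b. b \<in> C \<Longrightarrow> 0 \<le> f b" "f c = (\<Sum>b\<in>C. f b)" "b \<in> C - {c}"
  shows "f b = 0"
proof -
  have "(\<Sum>b\<in>C - {c}. f b) = 0"
    using assms(1,2,4) by (simp add: sum.remove)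
  then show ?thesis
    using assms by (subst (asm) sum_nonneg_eq_0_iff) auto
qed

section \<open>The case of equality\<close>

text \<open>Equality in the bound makes every estimate in its proof sharp. For \<open>k < card C\<close>, the peak column \<open>j\<close>
has an entry equal to half of its row sum, in row \<open>p\<close>, and at most one further nonzero entry, in row
\<open>q\<close>; the minors at these entries are extremal too. The further entry must exist, since otherwise the
minor at \<open>p\<close> would have rank at most \<open>k - 1\<close> and its permanent would be too small. Row \<open>q\<close> of the block
form of that minor cannot lie in a \<open>J2\<close> block, since the other row of the block and then row \<open>q\<close>
would force the kernel vector to vanish at \<open>j\<close>. So row \<open>q\<close> is supported in \<open>j\<close> and one further
column \<open>c\<close>. Comparing the two minors gives the entry at \<open>(p, c)\<close>, the kernel relation of row \<open>p\<close> gives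
\<open>x c = - 1\<close>, and that of row \<open>q\<close> then equates its two entries: rows \<open>p, q\<close> and columns \<open>j, c\<close> form a
\<open>J2\<close> block. For \<open>k \<ge> card C\<close>, equality says that exactly one hit is certain in any chosen column, so
the column meets a single row, whose other entries vanish: a unit block splits off.\<close>

theorem block_form_if_per_eq:
  assumes "finite R" "finite C" "card R = card C"
    and "\<And>i c. i \<in> R \<Longrightarrow> c \<in> C \<Longrightarrow> 0 \<le> a i c"
    and "factors_through k R C a"
    and "\<And>i. i \<in> R \<Longrightarrow> 0 < (\<Sum>c\<in>C. a i c)"
    and "per R C a = (1 / 2) ^ (card C - k) * (\<Prod>i\<in>R. \<Sum>c\<in>C. a i c)"
  shows "block_form a R C (card C - k)"
  using assms
proof (induction "card C" arbitrary: R C)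
  case 0
  then show ?case by (simp add: block_form.empty)
next
  case (Suc n)
  note fin = Suc.prems(1,2) and nonneg = Suc.prems(4) and fac = Suc.prems(5) and pos = Suc.prems(6)
  have n: "card C - 1 = n" using Suc.hyps(2) by simp
  define u where "u = (\<lambda>j i. \<Sum>c\<in>C - {j}. a i c)"
  define F where "F = (\<lambda>j. one_hit R (\<lambda>i. a i j) (u j))"
  define rows where "rows = (\<Prod>i\<in>R. \<Sum>c\<in>C. a i c)"
  have sums: "(\<Sum>c\<in>C. a i c) = a i j + u j i" if "j \<in> C" for i j
    using that fin(2) by (simp add: sum.remove u_def)
  have u_nonneg: "0 \<le> u j i" if "i \<in> R" for i j
    using nonneg that unfolding u_def by (intro sum_nonneg) auto
  have rows_pos: "0 < rows"
    unfolding rows_def using pos by (intro prod_pos) auto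
  have minors: "per (R - {i}) (C - {j}) a \<le> (1 / 2) ^ (n - k) * (\<Prod>l\<in>R - {i}. u j l)"
    if "j \<in> C" "i \<in> R" for i j
  proof -
    have "factors_through k (R - {i}) (C - {j}) a"
      using factors_through_subset[OF fac] by blast
    then have "per (R - {i}) (C - {j}) a
        \<le> (1 / 2) ^ (card (C - {j}) - k) * (\<Prod>l\<in>R - {i}. \<Sum>c\<in>C - {j}. a l c)"
      using fin Suc.prems(3) nonneg that by (intro per_le_of_factors_through) auto
    then show ?thesis
      unfolding u_def card_Diff_singleton[OF that(1)] n .
  qed
  have reduce: "per R C a \<le> (1 / 2) ^ (n - k) * F j" if "j \<in> C" for j
    unfolding F_def by (rule per_le_one_hit) (use fin nonneg that minors in auto)
  have tight: "per (R - {i}) (C - {j}) a = (1 / 2) ^ (n - k) * (\<Prod>l\<in>R - {i}. u j l)"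
    if "per R C a = (1 / 2) ^ (n - k) * F j" "j \<in> C" "i \<in> R" "0 < a i j" for i j
    by (rule minor_eq_if_per_eq_one_hit) (use fin nonneg minors that in \<open>auto simp: F_def\<close>)
  have IH: "block_form a (R - {i}) (C - {j}) (n - k)"
    if "per R C a = (1 / 2) ^ (n - k) * F j" "j \<in> C" "i \<in> R" "0 < a i j"
      "\<And>l. l \<in> R - {i} \<Longrightarrow> 0 < u j l" for i j
  proof -
    have c: "n = card (C - {j})" "card (R - {i}) = card (C - {j})"
      using Suc.hyps(2) Suc.prems(1-3) that(2,3) by simp_all
    show ?thesis
      unfolding c(1)
    proof (rule Suc.hyps(1)[OF c(1) _ _ c(2)])
      show "factors_through k (R - {i}) (C - {j}) a"
        using factors_through_subset[OF fac] by blast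
    qed (use fin nonneg that(5) tight[OF that(1-4)] in \<open>auto simp: u_def c(1)[symmetric]\<close>)
  qed
  show ?case
  proof (cases "k < card C")
    case False
    then have exps: "card C - k = 0" "n - k = 0"
      using Suc.hyps(2) by auto
    obtain j where j: "j \<in> C" using Suc.hyps(2) by fastforce
    \<comment> \<open>exactly one hit is certain, so no hit has probability zero and some row has no mass outside column \<open>j\<close>\<close>
    have "F j + (\<Prod>i\<in>R. u j i) \<le> rows"
      using one_hit_add_no_hit_le[of R "\<lambda>i. a i j" "u j"] fin nonneg u_nonneg j
      by (simp add: F_def rows_def sums[OF j])
    moreover have "rows \<le> F j"
      using reduce[OF j] Suc.prems(7) exps by (simp add: rows_def)
    moreover have "0 \<le> (\<Prod>i\<in>R. u j i)"
      using u_nonneg by (intro prod_nonneg) auto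
    ultimately have Fj: "F j = rows" and "(\<Prod>i\<in>R. u j i) = 0"
      by linarith+
    then obtain p where p: "p \<in> R" "u j p = 0"
      using fin(1) by auto
    have apj: "0 < a p j"
      using pos[OF p(1)] p(2) sums[OF j, of p] by simp
    obtain S where R: "R = insert p S" and S': "p \<notin> S"
      using p(1) by (meson mk_disjoint_insert)
    have finS: "finite S" using fin(1) R by simp
    have "a p j * (\<Prod>l\<in>S. u j l) = a p j * (\<Prod>l\<in>S. a l j + u j l)"
      using Fj finS S' p(2) by (simp add: F_def rows_def R one_hit_insert sums[OF j])
    then have prods: "(\<Prod>l\<in>S. u j l) = (\<Prod>l\<in>S. a l j + u j l)"
      using apj by simp
    moreover have "0 < (\<Prod>l\<in>S. a l j + u j l)"
      using pos by (intro prod_pos) (simp add: R sums[OF j])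
    ultimately have "(\<Prod>l\<in>S. u j l) \<noteq> 0" by simp
    then have u_pos: "0 < u j l" if "l \<in> S" for l
      using finS that u_nonneg[of l j] by (auto simp: R less_le)
    have "one_hit S (\<lambda>i. a i j) (u j) + (\<Prod>l\<in>S. u j l) \<le> (\<Prod>l\<in>S. a l j + u j l)"
      using one_hit_add_no_hit_le[of S "\<lambda>i. a i j" "u j"] finS nonneg u_nonneg j by (simp add: R)
    then have "\<not> 0 < one_hit S (\<lambda>i. a i j) (u j)"
      using prods by simp
    then have col: "a l j = 0" if "l \<in> S" for l
      using one_hit_pos[of S "\<lambda>i. a i j" "u j" l] finS u_pos nonneg[of _ j] j that
      by (force simp: R)
    have Rp: "R - {p} = S" using R S' by auto
    have "block_form a S (C - {j}) (n - k)"
      using IH[of j p] Suc.prems(7) Fj j p(1) apj u_pos exps by (simp add: rows_def Rp)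
    then have "block_form a (insert p S) (insert j (C - {j})) (n - k)"
    proof (rule block_form.unit)
      show "a p c = 0" if "c \<in> C - {j}" for c
        using zero_if_sum_remove_eq[OF fin(2) j _ _ that, of "a p"] nonneg p sums[OF j, of p] by simp
    qed (use S' apj col in auto)
    then show ?thesis
      using exps j R by (simp add: insert_absorb)
  next
    case True
    then have kn: "k \<le> n" and exps: "card C - k = Suc (n - k)"
      using Suc.hyps(2) by auto
    obtain x j where j: "j \<in> C" and xj: "x j = 1" and x: "\<And>c. c \<in> C \<Longrightarrow> \<bar>x c\<bar> \<le> 1"
      and ker: "\<And>i. i \<in> R \<Longrightarrow> (\<Sum>c\<in>C. a i c * x c) = 0"
      by (rule normalised_kernel_vector[OF fin(2) True fac]) metis
    \<comment> \<open>the column where \<open>x\<close> peaks carries at most half of each row\<close>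
    have half: "a i j \<le> u j i" if "i \<in> R" for i
      unfolding u_def by (rule kernel_peak_le_half[OF fin(2) j xj x ker]) (use nonneg that in auto)
    have u_pos: "0 < u j i" if "i \<in> R" for i
      using pos[OF that] half[OF that] u_nonneg[OF that, of j] sums[OF j, of i] by linarith
    have "2 * F j \<le> rows"
      using one_hit_le_half[of R "\<lambda>i. a i j" "u j"] fin nonneg half j
      by (simp add: F_def rows_def sums[OF j])
    moreover have per: "per R C a = (1 / 2) ^ (n - k) * (rows / 2)"
      using Suc.prems(7) by (simp add: exps rows_def)
    moreover have "rows / 2 \<le> F j"
      using reduce[OF j] unfolding per by (rule mult_left_le_imp_le) simp
    ultimately have F: "F j = rows / 2"
      by linarith
    have perF: "per R C a = (1 / 2) ^ (n - k) * F j"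
      unfolding F by (rule per)
    obtain p q where p: "p \<in> R" and apj: "a p j = u j p"
      and col: "\<And>l. l \<in> R - {p, q} \<Longrightarrow> a l j = 0"
    proof (rule one_hit_eq_half[of R "\<lambda>i. a i j" "u j"])
      show "2 * one_hit R (\<lambda>i. a i j) (u j) = (\<Prod>i\<in>R. a i j + u j i)"
        using F by (simp add: F_def rows_def sums[OF j])
    qed (use fin nonneg half j pos sums[OF j] in auto)
    have apj_pos: "0 < a p j" using apj u_pos[OF p] by simp
    have minor_p: "per (R - {p}) (C - {j}) a = (1 / 2) ^ (n - k) * (\<Prod>l\<in>R - {p}. u j l)"
      by (rule tight[OF perF j p apj_pos])
    have block_p: "block_form a (R - {p}) (C - {j}) (n - k)"
      using IH[OF perF j p apj_pos] u_pos by blast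
    \<comment> \<open>otherwise the minor at \<open>(p, j)\<close> has rank at most \<open>k - 1\<close>, which costs it another factor \<open>1 / 2\<close>\<close>
    have q: "q \<in> R" "q \<noteq> p" "a q j \<noteq> 0"
    proof -
      have "\<exists>l\<in>R - {p}. a l j \<noteq> 0"
      proof (rule ccontr)
        assume "\<not> (\<exists>l\<in>R - {p}. a l j \<noteq> 0)"
        then have "0 < k" and fac': "factors_through (k - 1) (R - {p}) (C - {j}) a"
          using factors_through_delete_pivot[OF fac fin(2) p j] apj_pos by auto
        have "per (R - {p}) (C - {j}) a
            \<le> (1 / 2) ^ (card (C - {j}) - (k - 1)) * (\<Prod>l\<in>R - {p}. \<Sum>c\<in>C - {j}. a l c)"
          by (rule per_le_of_factors_through) (use fin Suc.prems(3) p j nonneg fac' in auto)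
        moreover have "card (C - {j}) - (k - 1) = Suc (n - k)"
          using fin(2) j n kn \<open>0 < k\<close> by simp
        moreover have "0 < (\<Prod>l\<in>R - {p}. u j l)"
          using u_pos by (intro prod_pos) auto
        ultimately show False
          using minor_p by (simp add: u_def)
      qed
      then show "q \<in> R" "q \<noteq> p" "a q j \<noteq> 0"
        using col by auto
    qed
    have aqj: "0 < a q j"
      using q nonneg[OF q(1) j] by simp
    have "q \<in> R - {p}" using q by simp
    from block_p this show ?thesis
    proof (cases rule: block_form_row_cases)
      case (pair q' c c')
      then have "a q' j = 0" using col by auto
      have row: "(\<Sum>b\<in>C. a i b * x b) = a i j + a i c * (x c + x c')" if "i \<in> {q, q'}" for i
      proof -
        have "(\<Sum>b\<in>C - {j}. a i b * x b) = a i c * x c + a i c' * x c'"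
          by (rule sum_split_two) (use pair that fin(2) in auto)
        then show ?thesis
          using fin(2) j xj pair that by (auto simp: sum.remove algebra_simps)
      qed
      \<comment> \<open>row \<open>q'\<close> is supported in \<open>c\<close> and \<open>c'\<close> with equal entries\<close>
      have "x c + x c' = 0"
        using row[of q'] ker[of q'] pair \<open>a q' j = 0\<close> by auto
      then have False
        using row[of q] ker[OF q(1)] aqj by simp
      then show ?thesis ..
    next
      case (unit c)
      let ?R = "R - {p} - {q}" and ?C = "C - {j} - {c}"
      have cC: "c \<in> C" "c \<noteq> j" using unit by auto
      have rest: "(\<Sum>b\<in>?C. a l b) = u j l" if "l \<in> ?R" for l
        using unit that fin(2) by (simp add: u_def sum.remove[of "C - {j}" c])
      have "per ?R ?C a = (1 / 2) ^ (n - k) * (\<Prod>l\<in>?R. u j l)"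
        using block_form_per[OF unit(5)] rest by simp
      \<comment> \<open>the minor at \<open>(q, j)\<close>, once expanded along column \<open>c\<close> and once by its own extremality\<close>
      moreover have "per (R - {q}) (C - {j}) a = a p c * per ?R ?C a"
      proof -
        have "R - {q} - {p} = ?R" by auto
        then show ?thesis
          using per_expand_single[of "R - {q}" "C - {j}" c p a] unit fin p q by auto
      qed
      moreover have "per (R - {q}) (C - {j}) a = (1 / 2) ^ (n - k) * (u j p * (\<Prod>l\<in>?R. u j l))"
      proof -
        have "R - {q} = insert p ?R" using p q by auto
        then have "(\<Prod>l\<in>R - {q}. u j l) = u j p * (\<Prod>l\<in>?R. u j l)"
          using fin(1) by simp
        then show ?thesis
          using tight[OF perF j q(1) aqj] by simp
      qed
      moreover have "0 < (\<Prod>l\<in>?R. u j l)"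
        using u_pos by (intro prod_pos) auto
      ultimately have apc: "a p c = u j p"
        by simp
      have row_p: "a p b = 0" if "b \<in> ?C" for b
        using zero_if_sum_remove_eq[of "C - {j}" c "a p" b] fin(2) unit(1) nonneg p apc that
        by (simp add: u_def)
      have "(\<Sum>b\<in>C. a p b * x b) = a p j * x j + a p c * x c"
        by (rule sum_split_two) (use fin(2) j cC row_p in auto)
      then have "a p j * (1 + x c) = 0"
        using ker[OF p] apj apc xj by (simp add: algebra_simps)
      then have xc: "x c = -1"
        using apj_pos by simp
      have "(\<Sum>b\<in>C. a q b * x b) = a q j * x j + a q c * x c"
        by (rule sum_split_two) (use fin(2) j cC unit(3) in auto)
      then have aqc: "a q c = a q j"
        using ker[OF q(1)] xj xc by simp
      have "block_form a (insert p (insert q ?R)) (insert j (insert c ?C)) (Suc (n - k))"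
        by (rule block_form.pair[OF unit(5)])
          (use p q apj_pos aqj apj apc aqc cC row_p unit(3,4) col in auto)
      moreover have "insert p (insert q ?R) = R" "insert j (insert c ?C) = C"
        using p q j cC by auto
      ultimately show ?thesis
        using exps by simp
    qed
  qed
qed

section \<open>From index sets to matrices\<close>

text \<open>The entries of the direct sum of \<open>d\<close> copies of \<open>J2\<close> and an identity matrix of any order.\<close>

definition block_entry :: "nat \<Rightarrow> nat \<Rightarrow> nat \<Rightarrow> real" where
  "block_entry d p q =
    (if p < 2 * d then if p div 2 = q div 2 then 1 / 2 else 0 else if p = q then 1 else 0)"

lemma block_entry_commute: "block_entry d p q = block_entry d q p"
proof (cases "p div 2 = q div 2")
  case True
  have "r < 2 * d \<longleftrightarrow> r div 2 < d" for r
    by (simp add: div_less_iff_less_mult mult.commute)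
  then show ?thesis
    unfolding block_entry_def True by (simp only: True eq_commute[of p q])
next
  case False
  then have "p \<noteq> q" by blast
  with False show ?thesis
    by (simp add: block_entry_def)
qed

lemma block_entry_Suc_Suc: "block_entry (Suc d) (Suc (Suc p)) (Suc (Suc q)) = block_entry d p q"
  unfolding block_entry_def by auto

lemma diag_block_mat_J2_one:
  "diag_block_mat (replicate d J2 @ [1\<^sub>m m])
    = mat (2 * d + m) (2 * d + m) (\<lambda>(p, q). block_entry d p q)"
proof (induction d)
  case 0
  show ?case by (rule eq_matI) (auto simp: block_entry_def)
next
  case (Suc d)
  define D where "D = mat (2 * d + m) (2 * d + m) (\<lambda>(p, q). block_entry d p q)"
  have "diag_block_mat (replicate (Suc d) J2 @ [1\<^sub>m m])
      = four_block_mat J2 (0\<^sub>m 2 (2 * d + m)) (0\<^sub>m (2 * d + m) 2) D"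
    by (simp add: Suc Let_def D_def) (simp add: J2_def)
  also have "\<dots> = mat (2 * Suc d + m) (2 * Suc d + m) (\<lambda>(p, q). block_entry (Suc d) p q)"
  proof (rule eq_matI)
    fix p q
    assume "p < dim_row (mat (2 * Suc d + m) (2 * Suc d + m) (\<lambda>(p, q). block_entry (Suc d) p q))"
      and "q < dim_col (mat (2 * Suc d + m) (2 * Suc d + m) (\<lambda>(p, q). block_entry (Suc d) p q))"
    then have pq: "p < 2 + (2 * d + m)" "q < 2 + (2 * d + m)" by auto
    have index: "four_block_mat J2 (0\<^sub>m 2 (2 * d + m)) (0\<^sub>m (2 * d + m) 2) D $$ (p, q)
        = (if p < 2 then if q < 2 then 1 / 2 else 0
           else if q < 2 then 0 else block_entry d (p - 2) (q - 2))"
      using pq by (simp add: J2_def D_def)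
    have "p < 2 \<and> q < 2 \<or> p < 2 \<and> 2 \<le> q \<or> 2 \<le> p \<and> q < 2 \<or> 2 \<le> p \<and> 2 \<le> q" by linarith
    moreover have "block_entry (Suc d) p q = 1 / 2" if "p < 2" "q < 2"
      using that by (simp add: block_entry_def)
    moreover have "block_entry (Suc d) p q = 0" if "p < 2" "2 \<le> q"
      using that by (auto simp: block_entry_def)
    moreover have "block_entry (Suc d) p q = 0" if "2 \<le> p" "q < 2"
      using that by (auto simp: block_entry_def)
    moreover have "block_entry (Suc d) p q = block_entry d (p - 2) (q - 2)" if "2 \<le> p" "2 \<le> q"
      using that block_entry_Suc_Suc[of d "p - 2" "q - 2"] by (simp add: numeral_2_eq_2 Suc_diff_Suc)
    ultimately show "four_block_mat J2 (0\<^sub>m 2 (2 * d + m)) (0\<^sub>m (2 * d + m) 2) D $$ (p, q)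
        = mat (2 * Suc d + m) (2 * Suc d + m) (\<lambda>(p, q). block_entry (Suc d) p q) $$ (p, q)"
      unfolding index using pq by auto
  qed (simp_all add: J2_def D_def)
  finally show ?case .
qed

text \<open>The lists enumerate rows and columns block by block. A new \<open>J2\<close> block goes to the front and a new
unit to the end, so that all \<open>J2\<close> blocks precede the units in whichever order the blocks appear in the
derivation.\<close>

lemma block_form_imp_lists:
  assumes "block_form a R C d" "\<And>i. i \<in> R \<Longrightarrow> (\<Sum>c\<in>C. a i c) = 1"
  shows "\<exists>rs cs. distinct rs \<and> distinct cs \<and> set rs = R \<and> set cs = C \<and> length rs = length cs
    \<and> 2 * d \<le> length rs \<and> (\<forall>p<length rs. \<forall>q<length rs. a (rs ! p) (cs ! q) = block_entry d p q)"
  using assms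
proof (induction rule: block_form.induct)
  case empty
  show ?case by (intro exI[of _ "[]"]) simp
next
  case (unit R C d i j)
  note fin = block_form_finite[OF unit.hyps(1)]
  have "(\<Sum>c\<in>C. a r c) = 1" if "r \<in> R" for r
    using unit.prems[of r] that fin unit.hyps by simp
  then obtain rs cs where *: "distinct rs" "distinct cs" "set rs = R" "set cs = C"
    "length rs = length cs" "2 * d \<le> length rs"
    "\<And>p q. p < length rs \<Longrightarrow> q < length rs \<Longrightarrow> a (rs ! p) (cs ! q) = block_entry d p q"
    using unit.IH by blast
  have "a i j = 1"
    using unit.prems[of i] fin unit.hyps by simp
  have "a ((rs @ [i]) ! p) ((cs @ [j]) ! q) = block_entry d p q"
    if pq: "p < Suc (length rs)" "q < Suc (length rs)" for p q
  proof -
    consider "p < length rs" "q < length rs" | "p = length rs" "q < length rs"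
      | "p < length rs" "q = length rs" | "p = length rs" "q = length rs"
      using pq by (auto simp: less_Suc_eq)
    then show ?thesis
    proof cases
      case 1
      then show ?thesis using * by (simp add: nth_append)
    next
      case 2
      then have "cs ! q \<in> C" using * by (metis nth_mem)
      then show ?thesis
        using 2 * unit.hyps by (simp add: nth_append block_entry_def)
    next
      case 3
      then have "rs ! p \<in> R" using * by (metis nth_mem)
      moreover have "block_entry d p q = 0"
        using 3 *(6) by (subst block_entry_commute) (simp add: block_entry_def)
      ultimately show ?thesis
        using 3 * unit.hyps by (simp add: nth_append)
    next
      case 4
      then show ?thesis using * \<open>a i j = 1\<close> by (simp add: nth_append block_entry_def)
    qed
  qed
  then show ?case
    using * unit.hyps(2,3) by (intro exI[of _ "rs @ [i]"] exI[of _ "cs @ [j]"]) auto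
next
  case (pair R C d i i' j j')
  note fin = block_form_finite[OF pair.hyps(1)]
  have "(\<Sum>c\<in>C. a r c) = 1" if "r \<in> R" for r
    using pair.prems[of r] that fin pair.hyps by simp
  then obtain rs cs where *: "distinct rs" "distinct cs" "set rs = R" "set cs = C"
    "length rs = length cs" "2 * d \<le> length rs"
    "\<And>p q. p < length rs \<Longrightarrow> q < length rs \<Longrightarrow> a (rs ! p) (cs ! q) = block_entry d p q"
    using pair.IH by blast
  have halves: "a i j = 1 / 2" "a i j' = 1 / 2" "a i' j = 1 / 2" "a i' j' = 1 / 2"
    using pair.prems[of i] pair.prems[of i'] fin pair.hyps by simp_all
  have "a ((i # i' # rs) ! p) ((j # j' # cs) ! q) = block_entry (Suc d) p q"
    if "p < Suc (Suc (length rs))" "q < Suc (Suc (length rs))" for p q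
  proof -
    have "r < 2 \<or> (\<exists>r'. r = Suc (Suc r'))" for r :: nat
      by (cases r; cases "r - 1") auto
    then consider "p < 2" "q < 2" | q' where "p < 2" "q = Suc (Suc q')" | p' where "p = Suc (Suc p')" "q < 2"
      | p' q' where "p = Suc (Suc p')" "q = Suc (Suc q')"
      by blast
    then show ?thesis
    proof cases
      case 1
      then show ?thesis
        using halves by (auto simp: less_2_cases_iff block_entry_def)
    next
      case 2
      then have "cs ! q' \<in> C" using * that by (metis Suc_less_eq nth_mem)
      then show ?thesis
        using 2 pair.hyps(12) by (auto simp: less_2_cases_iff block_entry_def)
    next
      case 3
      then have "rs ! p' \<in> R" using * that by (metis Suc_less_eq nth_mem)
      then show ?thesis
        using 3 pair.hyps(13) by (auto simp: less_2_cases_iff block_entry_def)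
    next
      case 4
      then show ?thesis
        using * that by (simp add: block_entry_Suc_Suc)
    qed
  qed
  then show ?case
    using * pair.hyps(2-7) by (intro exI[of _ "i # i' # rs"] exI[of _ "j # j' # cs"]) auto
qed

lemma block_form_of_lists:
  assumes "distinct rs" "distinct cs" "length rs = 2 * d + m" "length cs = 2 * d + m"
    and "\<And>p q. p < 2 * d + m \<Longrightarrow> q < 2 * d + m \<Longrightarrow> a (rs ! p) (cs ! q) = block_entry d p q"
  shows "block_form a (set rs) (set cs) d"
  using assms
proof (induction d arbitrary: rs cs)
  case 0
  then show ?case
  proof (induction m arbitrary: rs cs)
    case 0
    then show ?case by (simp add: block_form.empty)
  next
    case (Suc m)
    obtain i rs' j cs' where eqs: "rs = i # rs'" "cs = j # cs'"
      using Suc.prems(3,4) by (cases rs; cases cs) auto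
    have entry: "a (rs ! p) (cs ! q) = (if p = q then 1 else 0)" if "p < Suc m" "q < Suc m" for p q
      using Suc.prems(5)[of p q] that by (simp add: block_entry_def)
    have len: "length rs' = m" "length cs' = m"
      using Suc.prems(3,4) eqs by auto
    have IH: "block_form a (set rs') (set cs') 0"
      by (rule Suc.IH) (use Suc.prems(1,2) len eqs entry[of "Suc _" "Suc _"] in \<open>auto simp: block_entry_def\<close>)
    have "a i c = 0" if "c \<in> set cs'" for c
      using that entry[of 0 "Suc _"] len eqs by (auto simp: in_set_conv_nth)
    moreover have "a r j = 0" if "r \<in> set rs'" for r
      using that entry[of "Suc _" 0] len eqs by (auto simp: in_set_conv_nth)
    ultimately show ?case
      using block_form.unit[OF IH, of i j] entry[of 0 0] eqs Suc.prems(1,2) by simp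
  qed
next
  case (Suc d)
  obtain i i' rs' where rs: "rs = i # i' # rs'"
    using Suc.prems(3) by (cases rs; cases "tl rs") auto
  obtain j j' cs' where cs: "cs = j # j' # cs'"
    using Suc.prems(4) by (cases cs; cases "tl cs") auto
  have len: "length rs' = 2 * d + m" "length cs' = 2 * d + m"
    using Suc.prems(3,4) rs cs by auto
  note entry = Suc.prems(5)
  have IH: "block_form a (set rs') (set cs') d"
  proof (rule Suc.IH)
    show "a (rs' ! p) (cs' ! q) = block_entry d p q" if "p < 2 * d + m" "q < 2 * d + m" for p q
      using entry[of "Suc (Suc p)" "Suc (Suc q)"] that by (simp add: rs cs block_entry_Suc_Suc)
  qed (use Suc.prems(1,2) len rs cs in auto)
  have halves: "a i j = 1 / 2" "a i j' = 1 / 2" "a i' j = 1 / 2" "a i' j' = 1 / 2"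
    using entry[of 0 0] entry[of 0 1] entry[of 1 0] entry[of 1 1] by (simp_all add: rs cs block_entry_def)
  have "a i c = 0 \<and> a i' c = 0" if "c \<in> set cs'" for c
  proof -
    obtain q where "q < 2 * d + m" "c = cs' ! q"
      using \<open>c \<in> set cs'\<close> len by (metis in_set_conv_nth)
    then show ?thesis
      using entry[of 0 "Suc (Suc q)"] entry[of 1 "Suc (Suc q)"] by (simp add: rs cs block_entry_def)
  qed
  moreover have "a r j = 0 \<and> a r j' = 0" if "r \<in> set rs'" for r
  proof -
    obtain p where "p < 2 * d + m" "r = rs' ! p"
      using \<open>r \<in> set rs'\<close> len by (metis in_set_conv_nth)
    then show ?thesis
      using entry[of "Suc (Suc p)" 0] entry[of "Suc (Suc p)" 1] by (simp add: rs cs block_entry_def)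
  qed
  ultimately show ?case
    using block_form.pair[OF IH, of i i' j j'] halves Suc.prems(1,2) by (simp add: rs cs)
qed

lemma permanent_eq_per_transpose:
  assumes "A \<in> carrier_mat n n"
  shows "permanent A = per {0..<n} {0..<n} (\<lambda>j i. A $$ (i, j))"
proof -
  let ?S = "{0..<n}"
  have "(\<Sum>\<sigma> | \<sigma> permutes ?S. \<Prod>i\<in>?S. A $$ (i, \<sigma> i))
      = (\<Sum>f | f \<in> ?S \<rightarrow>\<^sub>E ?S \<and> inj_on f ?S. \<Prod>i\<in>?S. A $$ (i, f i))"
  proof (rule sum.reindex_bij_witness[where i = "\<lambda>f x. if x \<in> ?S then f x else x"
        and j = "\<lambda>\<sigma>. restrict \<sigma> ?S"])
    fix f assume f: "f \<in> {f. f \<in> ?S \<rightarrow>\<^sub>E ?S \<and> inj_on f ?S}"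
    then have "f ` ?S = ?S"
      by (intro endo_inj_surj) (auto simp: PiE_iff)
    then have "bij_betw f ?S ?S"
      using f by (simp add: bij_betw_def)
    then have "bij_betw (\<lambda>x. if x \<in> ?S then f x else x) ?S ?S"
      using bij_betw_cong[of ?S "\<lambda>x. if x \<in> ?S then f x else x" f ?S] by simp
    then show "(\<lambda>x. if x \<in> ?S then f x else x) \<in> {\<sigma>. \<sigma> permutes ?S}"
      by (auto intro!: bij_imp_permutes)
    show "restrict (\<lambda>x. if x \<in> ?S then f x else x) ?S = f"
      using f by (auto simp: fun_eq_iff PiE_iff extensional_def)
  next
    fix \<sigma> assume \<sigma>: "\<sigma> \<in> {\<sigma>. \<sigma> permutes ?S}"
    then show "restrict \<sigma> ?S \<in> {f. f \<in> ?S \<rightarrow>\<^sub>E ?S \<and> inj_on f ?S}"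
      using permutes_in_image[of \<sigma> ?S] permutes_inj_on[of \<sigma> ?S ?S] by (auto simp: PiE_iff inj_on_def)
    show "(\<lambda>x. if x \<in> ?S then restrict \<sigma> ?S x else x) = \<sigma>"
      using \<sigma> by (auto simp: fun_eq_iff permutes_not_in)
  qed auto
  then show ?thesis
    using assms by (simp add: permanent_def per_def)
qed

lemma permanent_transpose:
  assumes "A \<in> carrier_mat n n"
  shows "permanent (transpose_mat A) = permanent A"
proof -
  let ?S = "{0..<n}"
  have "(\<Sum>\<sigma> | \<sigma> permutes ?S. \<Prod>i\<in>?S. A $$ (\<sigma> i, i))
      = (\<Sum>\<sigma> | \<sigma> permutes ?S. \<Prod>i\<in>?S. A $$ (Hilbert_Choice.inv \<sigma> i, i))"
    by (rule sum_permutations_inverse)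
  also have "\<dots> = (\<Sum>\<sigma> | \<sigma> permutes ?S. \<Prod>i\<in>?S. A $$ (i, \<sigma> i))"
  proof (rule sum.cong[OF refl])
    fix \<sigma> assume "\<sigma> \<in> {\<sigma>. \<sigma> permutes ?S}"
    then have \<sigma>: "\<sigma> permutes ?S" by simp
    have "(\<Prod>i\<in>?S. A $$ (Hilbert_Choice.inv \<sigma> i, i)) = (\<Prod>i\<in>?S. A $$ (Hilbert_Choice.inv \<sigma> (\<sigma> i), \<sigma> i))"
      using prod.permute[OF \<sigma>, of "\<lambda>i. A $$ (Hilbert_Choice.inv \<sigma> i, i)"] by (simp add: comp_def)
    then show "(\<Prod>i\<in>?S. A $$ (Hilbert_Choice.inv \<sigma> i, i)) = (\<Prod>i\<in>?S. A $$ (i, \<sigma> i))"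
      using permutes_inverses(2)[OF \<sigma>] by simp
  qed
  finally have main: "(\<Sum>\<sigma> | \<sigma> permutes ?S. \<Prod>i\<in>?S. A $$ (\<sigma> i, i))
      = (\<Sum>\<sigma> | \<sigma> permutes ?S. \<Prod>i\<in>?S. A $$ (i, \<sigma> i))" .
  have "permanent (transpose_mat A) = (\<Sum>\<sigma> | \<sigma> permutes ?S. \<Prod>i\<in>?S. A $$ (\<sigma> i, i))"
  proof -
    have "(\<Prod>i\<in>?S. transpose_mat A $$ (i, \<sigma> i)) = (\<Prod>i\<in>?S. A $$ (\<sigma> i, i))" if "\<sigma> permutes ?S" for \<sigma>
      using assms permutes_in_image[OF that] by (intro prod.cong) auto
    then have "(\<Sum>\<sigma> | \<sigma> permutes ?S. \<Prod>i\<in>?S. transpose_mat A $$ (i, \<sigma> i))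
        = (\<Sum>\<sigma> | \<sigma> permutes ?S. \<Prod>i\<in>?S. A $$ (\<sigma> i, i))"
      by (intro sum.cong) auto
    then show ?thesis
      using assms by (simp add: permanent_def)
  qed
  then show ?thesis
    using assms main by (simp add: permanent_def)
qed

lemma permanent_eq_per:
  assumes "A \<in> carrier_mat n n"
  shows "permanent A = per {0..<n} {0..<n} (\<lambda>i j. A $$ (i, j))"
proof -
  have "permanent A = permanent (transpose_mat A)"
    by (rule permanent_transpose[OF assms, symmetric])
  also have "\<dots> = per {0..<n} {0..<n} (\<lambda>i j. transpose_mat A $$ (j, i))"
    using permanent_eq_per_transpose[of "transpose_mat A" n] assms by simp
  also have "\<dots> = per {0..<n} {0..<n} (\<lambda>i j. A $$ (i, j))"
    using assms by (intro per_cong) auto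
  finally show ?thesis .
qed

lemma factors_through_mono:
  assumes "factors_through r R C a" "r \<le> k"
  shows "factors_through k R C a"
proof -
  obtain u w where uw: "\<forall>i\<in>R. \<forall>c\<in>C. a i c = (\<Sum>m<r. u i m * w m c)"
    using assms(1) unfolding factors_through_def by blast
  have "(\<Sum>m<k. (if m < r then u i m else 0) * w m c) = (\<Sum>m<r. u i m * w m c)" for i c
    using assms(2) by (intro sum.mono_neutral_cong_right) auto
  then show ?thesis
    using uw unfolding factors_through_def
    by (intro exI[of _ "\<lambda>i m. if m < r then u i m else 0"] exI[of _ w]) simp
qed

text \<open>A maximal independent set of columns spans all columns; its vectors and the coordinates with respect
to them are the two factors.\<close>

lemma factors_through_rank:
  fixes A :: "real mat"
  assumes A: "A \<in> carrier_mat n nc"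
  shows "factors_through (vec_space.rank n A) {0..<n} {0..<nc} (\<lambda>i j. A $$ (i, j))"
proof -
  interpret vec_space "TYPE(real)" n .
  have cols: "set (cols A) \<subseteq> carrier_vec n"
    using cols_dim A by blast
  have "lin_indpt {}"
    by (simp add: lin_dep_def)
  then obtain S where fS: "finite S" and max: "maximal S (\<lambda>T. T \<subseteq> set (cols A) \<and> lin_indpt T)"
    using maximal_exists_superset[of "set (cols A)" "\<lambda>T. T \<subseteq> set (cols A) \<and> lin_indpt T" "{}"] by auto
  have S: "S \<subseteq> set (cols A)" "lin_indpt S"
    using max by (auto simp: maximal_def)
  have SV: "S \<subseteq> carrier_vec n"
    using S(1) cols by blast
  have "\<exists>c. v = lincomb c S" if v: "v \<in> set (cols A)" for v
  proof -
    have "v \<in> span S"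
    proof (rule ccontr)
      assume nv: "v \<notin> span S"
      have vV: "v \<in> carrier_vec n" using v cols by blast
      have "v \<notin> S" using nv SV by (metis in_own_span subsetD)
      then have "lin_indpt (S \<union> {v})"
        using lin_dep_iff_in_span[of S v] SV S(2) vV nv by auto
      then have "S = S \<union> {v}"
        using max v S(1) unfolding maximal_def by blast
      then show False using \<open>v \<notin> S\<close> by blast
    qed
    then show ?thesis
      using finite_span[OF fS SV] by auto
  qed
  then have "\<forall>j\<in>{0..<nc}. \<exists>c. col A j = lincomb c S"
    using A by (metis atLeastLessThan_iff carrier_matD(2) cols_length cols_nth nth_mem)
  then obtain c where c: "\<And>j. j < nc \<Longrightarrow> col A j = lincomb (c j) S"
    by (metis atLeastLessThan_iff le0)
  obtain h where h: "bij_betw h {..<card S} S"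
    using ex_bij_betw_nat_finite[OF fS] unfolding lessThan_atLeast0 by blast
  have "A $$ (i, j) = (\<Sum>m<card S. h m $ i * c j (h m))" if "i < n" "j < nc" for i j
  proof -
    have "A $$ (i, j) = lincomb (c j) S $ i"
      using c[OF that(2)] A that by (metis carrier_matD index_col)
    also have "\<dots> = (\<Sum>v\<in>S. c j v * v $ i)"
      by (rule lincomb_index[OF that(1) SV])
    also have "\<dots> = (\<Sum>m<card S. c j (h m) * h m $ i)"
      by (rule sum.reindex_bij_betw[OF h, symmetric])
    finally show ?thesis by (simp add: mult.commute)
  qed
  then show ?thesis
    unfolding rank_card_indpt[OF A max] factors_through_def
    by (intro exI[of _ "\<lambda>i m. h m $ i"] exI[of _ "\<lambda>m j. c j (h m)"]) simp
qed

lemma permutation_product_index: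
  assumes D: "D \<in> carrier_mat n n" and \<sigma>: "\<sigma> permutes {0..<n}" and \<tau>: "\<tau> permutes {0..<n}"
    and ij: "i < n" "j < n"
  shows "(mat n n (\<lambda>(i, j). if j = \<sigma> i then 1 else 0) * D
      * mat n n (\<lambda>(i, j). if j = \<tau> i then 1 else 0)) $$ (i, j)
    = (D $$ (\<sigma> i, Hilbert_Choice.inv \<tau> j) :: real)"
proof -
  let ?P = "mat n n (\<lambda>(i, j). if j = \<sigma> i then 1 else 0) :: real mat"
  let ?Q = "mat n n (\<lambda>(i, j). if j = \<tau> i then 1 else 0) :: real mat"
  have \<sigma>i: "\<sigma> i < n" and \<tau>j: "Hilbert_Choice.inv \<tau> j < n"
    using ij permutes_in_image[OF \<sigma>, of i] permutes_in_image[OF permutes_inv[OF \<tau>], of j] by auto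
  have PD: "(?P * D) $$ (i, q) = D $$ (\<sigma> i, q)" if "q < n" for q
  proof -
    have "(?P * D) $$ (i, q) = (\<Sum>m = 0..<n. (if m = \<sigma> i then 1 else 0) * D $$ (m, q))"
      using D ij that by (simp add: scalar_prod_def)
    also have "\<dots> = (\<Sum>m = 0..<n. if m = \<sigma> i then D $$ (m, q) else 0)"
      by (intro sum.cong) auto
    finally show ?thesis using \<sigma>i by simp
  qed
  have "(?P * D * ?Q) $$ (i, j) = (\<Sum>m = 0..<n. (?P * D) $$ (i, m) * ?Q $$ (m, j))"
    using D ij by (simp add: scalar_prod_def)
  also have "\<dots> = (\<Sum>m = 0..<n. if m = Hilbert_Choice.inv \<tau> j then D $$ (\<sigma> i, m) else 0)"
  proof (rule sum.cong[OF refl])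
    fix m assume m: "m \<in> {0..<n}"
    have "j = \<tau> m \<longleftrightarrow> m = Hilbert_Choice.inv \<tau> j"
      using permutes_inverses[OF \<tau>] by metis
    then show "(?P * D) $$ (i, m) * ?Q $$ (m, j) = (if m = Hilbert_Choice.inv \<tau> j then D $$ (\<sigma> i, m) else 0)"
      using m ij PD by simp
  qed
  finally show ?thesis using \<tau>j by simp
qed

text \<open>The row permutation \<open>\<rho>\<close> is the inverse of the one defining \<open>P\<close>, while \<open>\<gamma>\<close> is the one defining \<open>Q\<close>.
The right-hand side treats rows and columns alike, and is therefore easy to transpose.\<close>

lemma permutation_equivalent_iff:
  assumes A: "A \<in> carrier_mat n n" and D: "D \<in> carrier_mat n n"
  shows "(\<exists>P Q. permutation_matrix n P \<and> permutation_matrix n Q \<and> A = P * D * Q)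
    \<longleftrightarrow> (\<exists>\<rho> \<gamma>. \<rho> permutes {0..<n} \<and> \<gamma> permutes {0..<n}
          \<and> (\<forall>p<n. \<forall>q<n. A $$ (\<rho> p, \<gamma> q) = D $$ (p, q)))" (is "?L \<longleftrightarrow> ?R")
proof
  assume ?L
  then obtain \<sigma> \<tau> where \<sigma>: "\<sigma> permutes {0..<n}" and \<tau>: "\<tau> permutes {0..<n}"
    and A_eq: "A = mat n n (\<lambda>(i, j). if j = \<sigma> i then 1 else 0) * D
      * mat n n (\<lambda>(i, j). if j = \<tau> i then 1 else 0)"
    unfolding permutation_matrix_def by blast
  have "A $$ (Hilbert_Choice.inv \<sigma> p, \<tau> q) = D $$ (p, q)" if "p < n" "q < n" for p q
  proof -
    have "Hilbert_Choice.inv \<sigma> p < n" "\<tau> q < n"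
      using that permutes_in_image[OF \<tau>, of q] permutes_in_image[OF permutes_inv[OF \<sigma>], of p] by auto
    then have "A $$ (Hilbert_Choice.inv \<sigma> p, \<tau> q) = D $$ (\<sigma> (Hilbert_Choice.inv \<sigma> p), Hilbert_Choice.inv \<tau> (\<tau> q))"
      unfolding A_eq by (rule permutation_product_index[OF D \<sigma> \<tau>])
    then show ?thesis
      using permutes_inverses[OF \<sigma>] permutes_inverses[OF \<tau>] by simp
  qed
  then show ?R
    using permutes_inv[OF \<sigma>] \<tau> by blast
next
  assume ?R
  then obtain \<rho> \<gamma> where \<rho>: "\<rho> permutes {0..<n}" and \<gamma>: "\<gamma> permutes {0..<n}"
    and entries: "\<And>p q. p < n \<Longrightarrow> q < n \<Longrightarrow> A $$ (\<rho> p, \<gamma> q) = D $$ (p, q)" by blast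
  let ?P = "mat n n (\<lambda>(i, j). if j = Hilbert_Choice.inv \<rho> i then 1 else 0) :: real mat"
  let ?Q = "mat n n (\<lambda>(i, j). if j = \<gamma> i then 1 else 0) :: real mat"
  have "A = ?P * D * ?Q"
  proof (rule eq_matI)
    fix i j assume "i < dim_row (?P * D * ?Q)" "j < dim_col (?P * D * ?Q)"
    then have ij: "i < n" "j < n" by auto
    have "Hilbert_Choice.inv \<rho> i < n" "Hilbert_Choice.inv \<gamma> j < n"
      using ij permutes_in_image[OF permutes_inv[OF \<gamma>], of j] permutes_in_image[OF permutes_inv[OF \<rho>], of i]
      by auto
    then have "A $$ (i, j) = D $$ (Hilbert_Choice.inv \<rho> i, Hilbert_Choice.inv \<gamma> j)"
      using entries[of "Hilbert_Choice.inv \<rho> i" "Hilbert_Choice.inv \<gamma> j"] permutes_inverses[OF \<rho>] permutes_inverses[OF \<gamma>] by simp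
    then show "A $$ (i, j) = (?P * D * ?Q) $$ (i, j)"
      using permutation_product_index[OF D permutes_inv[OF \<rho>] \<gamma> ij] by simp
  qed (use A in auto)
  then show ?L
    using permutes_inv[OF \<rho>] \<gamma> unfolding permutation_matrix_def by blast
qed

lemma permutation_equivalent_iff_block_form:
  assumes "A \<in> carrier_mat n n" "row_stochastic A" and n: "n = 2 * d + m"
  shows "(\<exists>\<rho> \<gamma>. \<rho> permutes {0..<n} \<and> \<gamma> permutes {0..<n}
        \<and> (\<forall>p<n. \<forall>q<n. A $$ (\<rho> p, \<gamma> q) = block_entry d p q))
    \<longleftrightarrow> block_form (\<lambda>i j. A $$ (i, j)) {0..<n} {0..<n} d" (is "?L \<longleftrightarrow> ?R")
proof
  assume ?L
  then obtain \<rho> \<gamma> where \<rho>: "\<rho> permutes {0..<n}" and \<gamma>: "\<gamma> permutes {0..<n}"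
    and entries: "\<And>p q. p < n \<Longrightarrow> q < n \<Longrightarrow> A $$ (\<rho> p, \<gamma> q) = block_entry d p q" by blast
  have "block_form (\<lambda>i j. A $$ (i, j)) (set (map \<rho> [0..<n])) (set (map \<gamma> [0..<n])) d"
    by (rule block_form_of_lists[where m = m])
      (use n entries \<rho> \<gamma> in \<open>auto simp: distinct_map intro: permutes_inj_on\<close>)
  then show ?R
    using permutes_image[OF \<rho>] permutes_image[OF \<gamma>] by simp
next
  assume ?R
  then obtain rs cs where *: "distinct rs" "distinct cs" "set rs = {0..<n}" "set cs = {0..<n}"
    and entries: "\<And>p q. p < length rs \<Longrightarrow> q < length rs \<Longrightarrow> A $$ (rs ! p, cs ! q) = block_entry d p q"
    using block_form_imp_lists[of "\<lambda>i j. A $$ (i, j)" "{0..<n}" "{0..<n}" d] assms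
    unfolding row_stochastic_def by auto
  have perm: "(\<lambda>p. if p < n then xs ! p else p) permutes {0..<n}"
    if "distinct xs" "set xs = {0..<n}" for xs :: "nat list"
  proof (rule bij_imp_permutes)
    have "length xs = n"
      using that distinct_card[of xs] by simp
    then have "bij_betw ((!) xs) {0..<n} {0..<n}"
      using bij_betw_nth[OF that(1) refl refl] unfolding that(2) lessThan_atLeast0 by simp
    then show "bij_betw (\<lambda>p. if p < n then xs ! p else p) {0..<n} {0..<n}"
      using bij_betw_cong[of "{0..<n}" "\<lambda>p. if p < n then xs ! p else p" "(!) xs" "{0..<n}"] by simp
  qed auto
  have "length rs = n"
    using * distinct_card[of rs] by simp
  then have "\<forall>p<n. \<forall>q<n. A $$ (if p < n then rs ! p else p, if q < n then cs ! q else q) = block_entry d p q"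
    using entries by simp
  then show ?L
    using perm[OF *(1,3)] perm[OF *(2,4)] by blast
qed

lemma row_stochastic_permanent:
  assumes A: "A \<in> carrier_mat n n" and row: "row_stochastic A"
    and fac: "factors_through k {0..<n} {0..<n} (\<lambda>i j. A $$ (i, j))"
  shows "permanent A \<le> (1 / 2) ^ (n - k)"
    and "permanent A = (1 / 2) ^ (n - k)
      \<longleftrightarrow> block_form (\<lambda>i j. A $$ (i, j)) {0..<n} {0..<n} (n - k)"
proof -
  let ?a = "\<lambda>i j. A $$ (i, j)"
  have sums: "(\<Sum>j\<in>{0..<n}. A $$ (i, j)) = 1" if "i \<in> {0..<n}" for i
    using row A that unfolding row_stochastic_def by auto
  have nonneg: "0 \<le> A $$ (i, j)" if "i \<in> {0..<n}" "j \<in> {0..<n}" for i j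
    using row A that unfolding row_stochastic_def nonneg_entries_def by auto
  have prod: "(\<Prod>i\<in>{0..<n}. \<Sum>j\<in>{0..<n}. ?a i j) = 1"
    using sums by simp
  show "permanent A \<le> (1 / 2) ^ (n - k)"
    using per_le_of_factors_through[of "{0..<n}" "{0..<n}" ?a k] nonneg fac prod
    by (simp add: permanent_eq_per[OF A])
  show "permanent A = (1 / 2) ^ (n - k) \<longleftrightarrow> block_form ?a {0..<n} {0..<n} (n - k)"
    using block_form_if_per_eq[of "{0..<n}" "{0..<n}" ?a k] nonneg fac prod sums
      block_form_per[of ?a "{0..<n}" "{0..<n}" "n - k"]
    by (auto simp: permanent_eq_per[OF A])
qed

theorem corollary1p3:
  fixes A :: "real mat" and k n :: nat
  assumes "real n / 2 < real k" and "k \<le> n"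
    and "A \<in> carrier_mat n n"
    and "row_stochastic A \<or> column_stochastic A"
    and "vec_space.rank n A \<le> k"
  shows "permanent A \<le> 1 / 2 ^ (n - k) \<and>
    (permanent A = 1 / 2 ^ (n - k) \<longleftrightarrow>
      (\<exists>P Q. permutation_matrix n P \<and> permutation_matrix n Q \<and>
        A = P * diag_block_mat (replicate (n - k) J2 @ [1\<^sub>m (2 * k - n)]) * Q))"
proof -
  note A = assms(3)
  have n: "n = 2 * (n - k) + (2 * k - n)"
    using assms(1,2) by linarith
  let ?E = "\<lambda>M. \<exists>\<rho> \<gamma>. \<rho> permutes {0..<n} \<and> \<gamma> permutes {0..<n}
    \<and> (\<forall>p<n. \<forall>q<n. M $$ (\<rho> p, \<gamma> q) = block_entry (n - k) p q)"
  have fac: "factors_through k {0..<n} {0..<n} (\<lambda>i j. A $$ (i, j))"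
    using factors_through_mono[OF factors_through_rank[OF A] assms(5)] .
  have row_case: "permanent M \<le> (1 / 2) ^ (n - k) \<and> (permanent M = (1 / 2) ^ (n - k) \<longleftrightarrow> ?E M)"
    if "M \<in> carrier_mat n n" "row_stochastic M"
      "factors_through k {0..<n} {0..<n} (\<lambda>i j. M $$ (i, j))" for M
    using row_stochastic_permanent[OF that] permutation_equivalent_iff_block_form[OF that(1,2) n] by simp
  have main: "permanent A \<le> (1 / 2) ^ (n - k) \<and> (permanent A = (1 / 2) ^ (n - k) \<longleftrightarrow> ?E A)"
    using assms(4)
  proof
    assume "row_stochastic A"
    then show ?thesis using row_case A fac by blast
  next
    assume col: "column_stochastic A"
    let ?T = "transpose_mat A"
    have T: "?T \<in> carrier_mat n n" using A by simp
    have "row_stochastic ?T"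
      using col A unfolding row_stochastic_def column_stochastic_def nonneg_entries_def by auto
    moreover have "factors_through k {0..<n} {0..<n} (\<lambda>i j. ?T $$ (i, j))"
      using factors_through_transpose[OF fac] A unfolding factors_through_def by auto
    moreover have "?E ?T \<longleftrightarrow> ?E A"
    proof -
      have index: "?T $$ (\<rho> p, \<gamma> q) = A $$ (\<gamma> q, \<rho> p)"
        if "\<rho> permutes {0..<n}" "\<gamma> permutes {0..<n}" "p < n" "q < n" for \<rho> \<gamma> p q
        using A that permutes_in_image[of \<rho> "{0..<n}" p] permutes_in_image[of \<gamma> "{0..<n}" q] by simp
      show ?thesis
      proof
        assume "?E ?T"
        then obtain \<rho> \<gamma> where "\<rho> permutes {0..<n}" "\<gamma> permutes {0..<n}"
          "\<forall>p<n. \<forall>q<n. ?T $$ (\<rho> p, \<gamma> q) = block_entry (n - k) p q" by blast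
        then show "?E A"
          by (intro exI[of _ \<gamma>] exI[of _ \<rho>]) (simp add: index block_entry_commute)
      next
        assume "?E A"
        then obtain \<rho> \<gamma> where "\<rho> permutes {0..<n}" "\<gamma> permutes {0..<n}"
          "\<forall>p<n. \<forall>q<n. A $$ (\<rho> p, \<gamma> q) = block_entry (n - k) p q" by blast
        then show "?E ?T"
          by (intro exI[of _ \<gamma>] exI[of _ \<rho>]) (simp add: index block_entry_commute)
      qed
    qed
    ultimately show ?thesis
      using row_case[OF T] permanent_transpose[OF A] by simp
  qed
  have "diag_block_mat (replicate (n - k) J2 @ [1\<^sub>m (2 * k - n)]) = mat n n (\<lambda>(p, q). block_entry (n - k) p q)"
    using diag_block_mat_J2_one[of "n - k" "2 * k - n"] n by simp
  then have "(\<exists>P Q. permutation_matrix n P \<and> permutation_matrix n Q \<and>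
        A = P * diag_block_mat (replicate (n - k) J2 @ [1\<^sub>m (2 * k - n)]) * Q) \<longleftrightarrow> ?E A"
    using permutation_equivalent_iff[OF A, of "mat n n (\<lambda>(p, q). block_entry (n - k) p q)"] by simp
  then show ?thesis
    using main by (simp add: power_one_over)
qed

end
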